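(* Let $\mathcal V$ and $\mathcal V^n$ be the variance processes given by $$d\mathcal V(t)=\mathfrak C\mathcal V(t)\,dt+d\mathcal L(t),\ \ \mathcal V(0)=\mathcal V_0,\qquad d\mathcal V^n(t)=\mathfrak C^n\mathcal V^n(t)\,dt+d\mathcal L^n(t),\ \ \mathcal V^n(0)=\mathcal V^n_0,$$ with $\mathcal V_0^n=\mathcal V_0$ and $\mathfrak C^n=\mathfrak C\in L(\mathcal B_1)$ for all $n\ge1$, where $\mathcal B_1$ denotes the Banach space of trace class operators on $H$ with norm $\|\cdot\|_1$, and where the compound Poisson processes $\mathcal L(t)=\sum_{i=1}^{N(t)}\mathcal X_i$ and $\mathcal L^n(t)=\sum_{i=1}^{N(t)}\mathcal X_i^n$ are driven by the same Poisson process $N$ (i.e. they jump simultaneously). Suppose that $\mathcal V(t)$ and $\mathcal V^n(t)$ are non-negative definite and trace class. Then there is a constant $k>0$ such that for every $T>0$, $$\mathbb E\Big[\sup_{0\le t\le T}\big\|\sqrt{\mathcal V(t)}-\sqrt{\mathcal V^n(t)}\big\|_{\mathcal H}^2\Big]\le C(T)\,\mathbb E\big[\|\mathcal X_i-\mathcal X_i^n\|_1\big],$$ where $C(T)=k\,e^{\|\mathfrak C\|_{\mathrm{op}}T}\lambda T$.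
   Context: $H$ is a separable real Hilbert space and $\mathcal H=L_{HS}(H)$ is the Hilbert space of Hilbert-Schmidt operators on $H$ with norm $\|\cdot\|_{\mathcal H}$. Trace class operators on $H$ are the compact operators with finite trace norm $\|\mathcal T\|_1:=\|(\mathcal T^*\mathcal T)^{1/4}\|_{\mathcal H}^2$. $\mathfrak C$ is a bounded operator on $\mathcal H$ that also acts as a bounded operator on $\mathcal B_1$; $\|\mathfrak C\|_{\mathrm{op}}$ is its operator norm in $L(\mathcal B_1)$. $N$ is a Poisson process with intensity $\lambda>0$; $(\mathcal X_i)_{i\ge1}$ and $(\mathcal X_i^n)_{i\ge1}$ are i.i.d. sequences of $\mathcal H$-valued random variables, independent of $N$; $i$ on the right-hand side is a generic index. The solution is $\mathcal V(t)=e^{\mathfrak Ct}\mathcal V_0+\int_0^te^{\mathfrak C(t-s)}d\mathcal L(s)=e^{\mathfrak Ct}\mathcal V_0+\sum_{i:T_i\le t}e^{\mathfrak C(t-T_i)}\mathcal X_i$, with $T_i$ the jump times of $N$; similarly for $\mathcal V^n$. "Non-negative definite" operators are self-adjoint, and $\sqrt A$ denotes the unique non-negative definite operator with $\sqrt A\sqrt A=A$. *)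

theory Defs
  imports "HOL-Probability.Probability"
begin

section \<open>Hilbert--Schmidt operators on a separable real Hilbert space\<close>

class separable_hilbert_space = real_inner + banach + second_countable_topology

definition is_onb :: "'a::real_inner set \<Rightarrow> bool" where
  "is_onb B \<longleftrightarrow> (\<forall>e\<in>B. norm e = 1) \<and> pairwise orthogonal B \<and> closure (span B) = UNIV"

definition some_onb :: "'a::real_inner set" where
  "some_onb = (SOME B. is_onb B)"

text \<open>The value does not depend on the orthonormal basis (Parseval), so a fixed one is used.
  It is the square of the Hilbert--Schmidt norm, and is infinite for a bounded operator that
  is not Hilbert--Schmidt.\<close>

definition hs_norm_sq :: "('a::real_inner \<Rightarrow>\<^sub>L 'a) \<Rightarrow> ennreal" where
  "hs_norm_sq A = (\<Sum>\<^sub>\<infinity>e\<in>some_onb. ennreal ((norm (blinfun_apply A e))\<^sup>2))"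

definition hilbert_schmidt :: "('a::real_inner \<Rightarrow>\<^sub>L 'a) \<Rightarrow> bool" where
  "hilbert_schmidt A \<longleftrightarrow> hs_norm_sq A < \<infinity>"

subsection \<open>Existence of an orthonormal basis\<close>

fun gram_schmidt_seq :: "(nat \<Rightarrow> 'a::real_inner) \<Rightarrow> nat \<Rightarrow> 'a" where
  "gram_schmidt_seq d n = d n - (\<Sum>m<n.
     ((d n \<bullet> gram_schmidt_seq d m) / (gram_schmidt_seq d m \<bullet> gram_schmidt_seq d m))
       *\<^sub>R gram_schmidt_seq d m)"

declare gram_schmidt_seq.simps [simp del]

lemma gram_schmidt_seq_orthogonal_less:
  "m < n \<Longrightarrow> gram_schmidt_seq d n \<bullet> gram_schmidt_seq d m = 0"
proof (induction n arbitrary: m rule: less_induct)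
  case (less n)
  let ?g = "gram_schmidt_seq d"
  have orth: "?g j \<bullet> ?g m = 0" if "j < n" "j \<noteq> m" for j
    using less.IH[of j m] less.IH[of m j] less.prems that
    by (cases "j < m") (auto simp: inner_commute)
  have "?g n \<bullet> ?g m
      = d n \<bullet> ?g m - (\<Sum>j<n. ((d n \<bullet> ?g j) / (?g j \<bullet> ?g j)) * (?g j \<bullet> ?g m))"
    by (subst gram_schmidt_seq.simps) (simp add: inner_diff_left inner_sum_left)
  also have "(\<Sum>j<n. ((d n \<bullet> ?g j) / (?g j \<bullet> ?g j)) * (?g j \<bullet> ?g m))
      = (\<Sum>j\<in>{m}. ((d n \<bullet> ?g j) / (?g j \<bullet> ?g j)) * (?g j \<bullet> ?g m))"
    by (rule sum.mono_neutral_right) (use less.prems orth in auto)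
  also have "\<dots> = d n \<bullet> ?g m"
    by (cases "?g m = 0") auto
  finally show ?case by simp
qed

lemma gram_schmidt_seq_orthogonal:
  "m \<noteq> n \<Longrightarrow> gram_schmidt_seq d n \<bullet> gram_schmidt_seq d m = 0"
  using gram_schmidt_seq_orthogonal_less[of m n d] gram_schmidt_seq_orthogonal_less[of n m d]
  by (metis inner_commute linorder_neqE_nat)

lemma is_onb_exists: "\<exists>B::'a::separable_hilbert_space set. is_onb B"
proof -
  obtain D :: "'a set" where D: "countable D" "\<And>X. open X \<Longrightarrow> X \<noteq> {} \<Longrightarrow> \<exists>d\<in>D. d \<in> X"
    using countable_dense_setE by blast
  have "D \<noteq> {}" using D(2)[of UNIV] by auto
  define d where "d = from_nat_into D"
  have rd: "range d = D"
    unfolding d_def using \<open>D \<noteq> {}\<close> D(1) by (rule range_from_nat_into)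
  let ?g = "gram_schmidt_seq d"
  define B where "B = {?g n /\<^sub>R norm (?g n) | n. ?g n \<noteq> 0}"
  have g_span: "?g n \<in> span B" for n
  proof (cases "?g n = 0")
    case False
    then have "?g n /\<^sub>R norm (?g n) \<in> span B"
      by (intro span_base) (auto simp: B_def)
    then have "norm (?g n) *\<^sub>R (?g n /\<^sub>R norm (?g n)) \<in> span B"
      by (rule span_scale)
    with False show ?thesis by simp
  qed (simp add: span_zero)
  have d_span: "d n \<in> span B" for n
  proof -
    have "d n = ?g n + (\<Sum>m<n. ((d n \<bullet> ?g m) / (?g m \<bullet> ?g m)) *\<^sub>R ?g m)"
      by (subst gram_schmidt_seq.simps[of d n]) simp
    also have "\<dots> \<in> span B"
      by (intro span_add span_sum span_scale g_span)
    finally show ?thesis .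
  qed
  have "x \<in> closure (span B)" for x
    unfolding closure_approachable
  proof (intro allI impI)
    fix e :: real assume "e > 0"
    then obtain y where "y \<in> D" "y \<in> ball x e" using D(2)[of "ball x e"] by auto
    moreover then have "y \<in> span B" using d_span rd by auto
    ultimately show "\<exists>y\<in>span B. dist y x < e" by (auto simp: dist_commute)
  qed
  moreover have "pairwise orthogonal B"
  proof (rule pairwiseI)
    fix x y assume "x \<in> B" "y \<in> B" "x \<noteq> y"
    then obtain m n where "x = ?g m /\<^sub>R norm (?g m)" "y = ?g n /\<^sub>R norm (?g n)" "m \<noteq> n"
      by (auto simp: B_def)
    then show "orthogonal x y"
      by (simp add: orthogonal_def gram_schmidt_seq_orthogonal)
  qed
  moreover have "\<forall>e\<in>B. norm e = 1"
    by (auto simp: B_def)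
  ultimately have "is_onb B" by (auto simp: is_onb_def)
  then show ?thesis ..
qed

lemma is_onb_some_onb: "is_onb (some_onb :: 'a::separable_hilbert_space set)"
  unfolding some_onb_def by (rule someI_ex) (rule is_onb_exists)

lemma some_onb_norm: "e \<in> (some_onb :: 'a::separable_hilbert_space set) \<Longrightarrow> norm e = 1"
  using is_onb_some_onb by (auto simp: is_onb_def)

lemma some_onb_inner:
  assumes "e \<in> (some_onb :: 'a::separable_hilbert_space set)" "f \<in> some_onb"
  shows "e \<bullet> f = (if e = f then 1 else 0)"
proof (cases "e = f")
  case True
  then show ?thesis using some_onb_norm[OF assms(1)] by (simp add: dot_square_norm)
next
  case False
  then show ?thesis
    using is_onb_some_onb assms by (auto simp: is_onb_def pairwise_def orthogonal_def)
qed

lemma countable_some_onb: "countable (some_onb :: 'a::separable_hilbert_space set)"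
proof -
  let ?B = "some_onb :: 'a set"
  have d: "dist e f > 1" if "e \<in> ?B" "f \<in> ?B" "e \<noteq> f" for e f
  proof -
    have "(dist e f)\<^sup>2 = 2"
      using that some_onb_norm[of e] some_onb_norm[of f] some_onb_inner[of e f]
      by (simp add: dist_norm power2_norm_eq_inner inner_diff_left inner_diff_right
          inner_commute some_onb_inner)
    then show ?thesis
      by (metis one_less_numeral_iff power_less_imp_less_base power_one semiring_norm(76)
          zero_le_dist)
  qed
  have disj: "ball e (1/2) \<inter> ball f (1/2) = {}" if "e \<in> ?B" "f \<in> ?B" "e \<noteq> f" for e f
  proof (rule ccontr)
    assume "ball e (1/2) \<inter> ball f (1/2) \<noteq> {}"
    then obtain z where "dist e z < 1/2" "dist f z < 1/2" by auto
    then show False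
      using d[OF that] dist_triangle[of e f z] by (simp add: dist_commute)
  qed
  have "countable ((\<lambda>e. ball e (1/2)) ` ?B)"
  proof (rule countable_disjoint_open_subsets)
    show "pairwise disjnt ((\<lambda>e. ball e (1/2)) ` ?B)"
      using disj by (intro pairwise_imageI) (auto simp: disjnt_def)
  qed auto
  moreover have "inj_on (\<lambda>e. ball e (1/2)) ?B"
  proof (rule inj_onI)
    fix e f assume *: "e \<in> ?B" "f \<in> ?B" and eq: "ball e (1/2) = ball f (1/2)"
    show "e = f"
    proof (rule ccontr)
      assume "e \<noteq> f"
      then have "ball e (1/2) = {}" using disj[OF *] eq by simp
      then show False by simp
    qed
  qed
  ultimately show ?thesis by (rule countable_image_inj_on)
qed

subsection \<open>The separable Hilbert space of Hilbert--Schmidt operators\<close>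

lemma hs_norm_sq_SUP:
  "hs_norm_sq A = (SUP F\<in>{F. finite F \<and> F \<subseteq> some_onb}. ennreal (\<Sum>e\<in>F. (norm (A e))\<^sup>2))"
  unfolding hs_norm_sq_def
  by (subst nonneg_infsum_complete) (auto simp: sum_ennreal)

lemma hilbert_schmidtI:
  assumes "\<And>F. finite F \<Longrightarrow> F \<subseteq> some_onb \<Longrightarrow> (\<Sum>e\<in>F. (norm (blinfun_apply A e))\<^sup>2) \<le> c"
  shows "hilbert_schmidt A"
proof -
  have "hs_norm_sq A \<le> ennreal c"
    unfolding hs_norm_sq_SUP using assms by (auto intro!: SUP_least ennreal_leI)
  then show ?thesis by (auto simp: hilbert_schmidt_def intro: le_less_trans)
qed

lemma hilbert_schmidt_summable:
  assumes "hilbert_schmidt A"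
  shows "(\<lambda>e. (norm (blinfun_apply A e))\<^sup>2) summable_on some_onb"
proof (rule nonneg_bdd_above_summable_on)
  from assms obtain c where c: "hs_norm_sq A = ennreal c" "c \<ge> 0"
    unfolding hilbert_schmidt_def by (cases "hs_norm_sq A") auto
  have "(\<Sum>e\<in>F. (norm (A e))\<^sup>2) \<le> c" if "finite F" "F \<subseteq> some_onb" for F
  proof -
    have "ennreal (\<Sum>e\<in>F. (norm (A e))\<^sup>2) \<le> hs_norm_sq A"
      unfolding hs_norm_sq_SUP using that by (intro SUP_upper) auto
    then show ?thesis using c by simp
  qed
  then show "bdd_above (sum (\<lambda>e. (norm (A e))\<^sup>2) ` {F. F \<subseteq> some_onb \<and> finite F})"
    by (intro bdd_aboveI[of _ c]) auto
qed simp

lemma hilbert_schmidt_iff_summable: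
  "hilbert_schmidt A \<longleftrightarrow> (\<lambda>e. (norm (blinfun_apply A e))\<^sup>2) summable_on some_onb"
proof
  assume s: "(\<lambda>e. (norm (A e))\<^sup>2) summable_on some_onb"
  show "hilbert_schmidt A"
    by (rule hilbert_schmidtI, rule finite_sum_le_infsum[OF s]) auto
qed (rule hilbert_schmidt_summable)

lemma hs_norm_sq_infsum:
  assumes "hilbert_schmidt A"
  shows "hs_norm_sq A = ennreal (\<Sum>\<^sub>\<infinity>e\<in>some_onb. (norm (blinfun_apply A e))\<^sup>2)"
  unfolding hs_norm_sq_SUP
  by (subst infsum_nonneg_is_SUPREMUM_ennreal[OF hilbert_schmidt_summable[OF assms]]) auto

lemma hs_inner_summable:
  assumes "hilbert_schmidt A" "hilbert_schmidt B"
  shows "(\<lambda>e. blinfun_apply A e \<bullet> blinfun_apply B e) summable_on some_onb"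
proof -
  have s: "(\<lambda>e. (norm (A e))\<^sup>2 + (norm (B e))\<^sup>2) summable_on some_onb"
    by (intro summable_on_add hilbert_schmidt_summable assms)
  have "(\<lambda>e. norm (A e \<bullet> B e)) summable_on some_onb"
  proof (rule Infinite_Sum.abs_summable_on_comparison_test')
    show "(\<lambda>e. (norm (A e))\<^sup>2 + (norm (B e))\<^sup>2) summable_on some_onb" by (rule s)
    fix e
    have "norm (A e \<bullet> B e) \<le> norm (A e) * norm (B e)"
      using Cauchy_Schwarz_ineq2[of "A e" "B e"] by simp
    also have "\<dots> \<le> (norm (A e))\<^sup>2 + (norm (B e))\<^sup>2"
      using sum_squares_bound[of "norm (A e)" "norm (B e)"]
        mult_nonneg_nonneg[OF norm_ge_zero[of "A e"] norm_ge_zero[of "B e"]]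
      by linarith
    finally show "norm (A e \<bullet> B e) \<le> (norm (A e))\<^sup>2 + (norm (B e))\<^sup>2" .
  qed
  then show ?thesis by (rule Infinite_Sum.abs_summable_summable)
qed

lemma hilbert_schmidt_0: "hilbert_schmidt 0"
  by (rule hilbert_schmidtI[of _ 0]) simp

lemma hilbert_schmidt_scaleR: "hilbert_schmidt A \<Longrightarrow> hilbert_schmidt (c *\<^sub>R A)"
  unfolding hilbert_schmidt_iff_summable
  by (simp add: blinfun.scaleR_left power_mult_distrib summable_on_cmult_right)

lemma hilbert_schmidt_add:
  assumes "hilbert_schmidt A" "hilbert_schmidt B"
  shows "hilbert_schmidt (A + B)"
proof -
  have "(\<lambda>e. (norm (A e))\<^sup>2 + 2 * (A e \<bullet> B e) + (norm (B e))\<^sup>2) summable_on some_onb"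
    by (intro summable_on_add summable_on_cmult_right hilbert_schmidt_summable
        hs_inner_summable assms)
  then show ?thesis
    unfolding hilbert_schmidt_iff_summable
    by (rule summable_on_cong[THEN iffD1, rotated])
      (simp add: power2_norm_eq_inner blinfun.add_left inner_add_left inner_add_right
        inner_commute)
qed

lemma hilbert_schmidt_uminus: "hilbert_schmidt A \<Longrightarrow> hilbert_schmidt (- A)"
  using hilbert_schmidt_scaleR[of A "-1"] by simp

lemma hilbert_schmidt_diff:
  "hilbert_schmidt A \<Longrightarrow> hilbert_schmidt B \<Longrightarrow> hilbert_schmidt (A - B)"
  using hilbert_schmidt_add[of A "- B"] hilbert_schmidt_uminus[of B] by simp

typedef (overloaded) 'a hs = "{A :: 'a::separable_hilbert_space \<Rightarrow>\<^sub>L 'a. hilbert_schmidt A}"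
  morphisms op_of_hs Abs_hs
  using hilbert_schmidt_0 by blast

setup_lifting type_definition_hs

lemma norm_apply_onb_bound:
  fixes A :: "'a::separable_hilbert_space \<Rightarrow>\<^sub>L 'a"
  assumes "\<And>F. finite F \<Longrightarrow> F \<subseteq> some_onb \<Longrightarrow> (\<Sum>e\<in>F. (norm (A e))\<^sup>2) \<le> c\<^sup>2" "c \<ge> 0"
  shows "norm A \<le> c"
proof (rule norm_blinfun_bound)
  fix x :: 'a
  have "span some_onb \<subseteq> {x. norm (A x) \<le> c * norm x}"
  proof
    fix x :: 'a assume "x \<in> span some_onb"
    then obtain F u where F: "finite F" "F \<subseteq> some_onb" and x: "x = (\<Sum>e\<in>F. u e *\<^sub>R e)"
      by (auto simp: span_explicit)
    have "(norm x)\<^sup>2 = (\<Sum>e\<in>F. \<Sum>f\<in>F. u e * (u f * (f \<bullet> e)))"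
      by (simp add: power2_norm_eq_inner x inner_sum_left inner_sum_right sum_distrib_left)
    also have "\<dots> = (\<Sum>e\<in>F. \<Sum>f\<in>F. if e = f then u e * u f else 0)"
      by (intro sum.cong refl) (use F in \<open>auto simp: some_onb_inner subset_iff\<close>)
    also have "\<dots> = (\<Sum>e\<in>F. (u e)\<^sup>2)"
      using F(1) by (simp add: power2_eq_square)
    finally have nx: "norm x = L2_set u F"
      by (simp add: L2_set_def real_sqrt_unique)
    have "norm (A x) \<le> (\<Sum>e\<in>F. \<bar>u e\<bar> * norm (A e))"
      unfolding x blinfun.sum_right blinfun.scaleR_right
      by (rule order_trans[OF norm_sum]) simp
    also have "\<dots> \<le> L2_set u F * L2_set (\<lambda>e. norm (A e)) F"
      using L2_set_mult_ineq[of u "\<lambda>e. norm (A e)" F] by simp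
    also have "\<dots> \<le> L2_set u F * c"
    proof (rule mult_left_mono)
      show "L2_set (\<lambda>e. norm (A e)) F \<le> c"
        unfolding L2_set_def using assms(1)[OF F] assms(2)
        by (metis real_sqrt_le_mono real_sqrt_unique)
    qed simp
    finally show "x \<in> {x. norm (A x) \<le> c * norm x}"
      by (simp add: nx mult.commute)
  qed
  moreover have "closed {x. norm (A x) \<le> c * norm x}"
    by (intro closed_Collect_le continuous_intros)
  ultimately have "closure (span some_onb) \<subseteq> {x. norm (A x) \<le> c * norm x}"
    by (rule closure_minimal)
  then show "norm (A x) \<le> c * norm x"
    using is_onb_some_onb[where 'a='a] by (auto simp: is_onb_def)
qed fact

instantiation hs :: (separable_hilbert_space) real_inner
begin

lift_definition zero_hs :: "'a hs" is 0 by (rule hilbert_schmidt_0)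

lift_definition plus_hs :: "'a hs \<Rightarrow> 'a hs \<Rightarrow> 'a hs" is "(+)" by (rule hilbert_schmidt_add)

lift_definition minus_hs :: "'a hs \<Rightarrow> 'a hs \<Rightarrow> 'a hs" is "(-)" by (rule hilbert_schmidt_diff)

lift_definition uminus_hs :: "'a hs \<Rightarrow> 'a hs" is uminus by (rule hilbert_schmidt_uminus)

lift_definition scaleR_hs :: "real \<Rightarrow> 'a hs \<Rightarrow> 'a hs" is scaleR by (rule hilbert_schmidt_scaleR)

lift_definition inner_hs :: "'a hs \<Rightarrow> 'a hs \<Rightarrow> real" is
  "\<lambda>A B. \<Sum>\<^sub>\<infinity>e\<in>some_onb. blinfun_apply A e \<bullet> blinfun_apply B e" .

definition norm_hs :: "'a hs \<Rightarrow> real" where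
  "norm_hs A = sqrt (A \<bullet> A)"

definition dist_hs :: "'a hs \<Rightarrow> 'a hs \<Rightarrow> real" where
  "dist_hs A B = norm (A - B)"

definition sgn_hs :: "'a hs \<Rightarrow> 'a hs" where
  "sgn_hs A = scaleR (inverse (norm A)) A"

definition uniformity_hs :: "('a hs \<times> 'a hs) filter" where
  "uniformity_hs = (INF e\<in>{0<..}. principal {(A, B). dist A B < e})"

definition open_hs :: "'a hs set \<Rightarrow> bool" where
  "open_hs S \<longleftrightarrow> (\<forall>A\<in>S. \<forall>\<^sub>F (A', B) in uniformity. A' = A \<longrightarrow> B \<in> S)"

instance
proof
  fix A B C :: "'a hs" and r s :: real and S :: "'a hs set"
  show "A + B + C = A + (B + C)" by transfer simp
  show "A + B = B + A" by transfer simp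
  show "0 + A = A" by transfer simp
  show "- A + A = 0" by transfer simp
  show "A - B = A + - B" by transfer simp
  show "r *\<^sub>R (A + B) = r *\<^sub>R A + r *\<^sub>R B" by transfer (rule scaleR_add_right)
  show "(r + s) *\<^sub>R A = r *\<^sub>R A + s *\<^sub>R A" by transfer (rule scaleR_add_left)
  show "r *\<^sub>R s *\<^sub>R A = (r * s) *\<^sub>R A" by transfer simp
  show "1 *\<^sub>R A = A" by transfer simp
  show "sgn A = inverse (norm A) *\<^sub>R A" by (rule sgn_hs_def)
  show "dist A B = norm (A - B)" by (rule dist_hs_def)
  show "uniformity = (INF e\<in>{0<..}. principal {(A::'a hs, B). dist A B < e})"
    by (rule uniformity_hs_def)
  show "open S \<longleftrightarrow> (\<forall>A\<in>S. \<forall>\<^sub>F (A', B) in uniformity. A' = A \<longrightarrow> B \<in> S)"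
    by (rule open_hs_def)
  show "A \<bullet> B = B \<bullet> A" by transfer (simp add: inner_commute)
  show "(A + B) \<bullet> C = A \<bullet> C + B \<bullet> C"
    by transfer
      (simp add: blinfun.add_left inner_add_left infsum_add hs_inner_summable)
  show "(r *\<^sub>R A) \<bullet> B = r * (A \<bullet> B)"
    by transfer (simp add: blinfun.scaleR_left infsum_cmult_right')
  show "0 \<le> A \<bullet> A" by transfer (simp add: infsum_nonneg)
  show "norm A = sqrt (A \<bullet> A)" by (rule norm_hs_def)
  show "(A \<bullet> A = 0) = (A = 0)"
  proof transfer
    fix A :: "'a \<Rightarrow>\<^sub>L 'a" assume A: "hilbert_schmidt A"
    have "A = 0" if 0: "(\<Sum>\<^sub>\<infinity>e\<in>some_onb. A e \<bullet> A e) = 0"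
    proof -
      have "(\<Sum>e\<in>F. (norm (A e))\<^sup>2) \<le> 0\<^sup>2" if "finite F" "F \<subseteq> some_onb" for F
        using finite_sum_le_infsum[OF hilbert_schmidt_summable[OF A] that] 0
        by (simp add: power2_norm_eq_inner)
      then have "norm A \<le> 0" by (rule norm_apply_onb_bound) auto
      then show ?thesis by simp
    qed
    then show "((\<Sum>\<^sub>\<infinity>e\<in>some_onb. A e \<bullet> A e) = 0) = (A = 0)" by auto
  qed
qed

end

lemma norm_hs_power2_infsum:
  "(norm A)\<^sup>2 = (\<Sum>\<^sub>\<infinity>e\<in>some_onb. (norm (blinfun_apply (op_of_hs A) e))\<^sup>2)"
  unfolding power2_norm_eq_inner by transfer simp

lemma norm_hs_power2: "ennreal ((norm A)\<^sup>2) = hs_norm_sq (op_of_hs A)"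
  using hs_norm_sq_infsum[of "op_of_hs A"] op_of_hs[of A] norm_hs_power2_infsum[of A] by simp

lemma norm_hs_leI:
  assumes "\<And>F. finite F \<Longrightarrow> F \<subseteq> some_onb \<Longrightarrow>
      (\<Sum>e\<in>F. (norm (blinfun_apply (op_of_hs A) e))\<^sup>2) \<le> c\<^sup>2" "c \<ge> 0"
  shows "norm A \<le> c"
proof -
  have "(norm A)\<^sup>2 \<le> c\<^sup>2"
    unfolding norm_hs_power2_infsum
    by (rule infsum_le_finite_sums[OF hilbert_schmidt_summable assms(1)])
      (use op_of_hs[of A] in auto)
  then show ?thesis using assms(2) by (rule power2_le_imp_le)
qed

lemma sum_le_norm_hs:
  assumes "finite F" "F \<subseteq> some_onb"
  shows "(\<Sum>e\<in>F. (norm (blinfun_apply (op_of_hs A) e))\<^sup>2) \<le> (norm A)\<^sup>2"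
  unfolding norm_hs_power2_infsum
  by (rule finite_sum_le_infsum[OF hilbert_schmidt_summable assms]) (use op_of_hs[of A] in auto)

lemma norm_op_of_hs_le: "norm (op_of_hs A) \<le> norm A"
  by (rule norm_apply_onb_bound) (auto intro: sum_le_norm_hs)

instance hs :: (separable_hilbert_space) banach
proof
  fix X :: "nat \<Rightarrow> 'a hs" assume X: "Cauchy X"
  have "Cauchy (\<lambda>n. op_of_hs (X n))"
  proof (rule metric_CauchyI)
    fix e :: real assume "e > 0"
    then obtain M where M: "\<And>m n. m \<ge> M \<Longrightarrow> n \<ge> M \<Longrightarrow> dist (X m) (X n) < e"
      using metric_CauchyD[OF X] by blast
    have "dist (op_of_hs (X m)) (op_of_hs (X n)) < e" if "m \<ge> M" "n \<ge> M" for m n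
      using norm_op_of_hs_le[of "X m - X n"] M[OF that]
      by (simp add: dist_norm minus_hs.rep_eq)
    then show "\<exists>M. \<forall>m\<ge>M. \<forall>n\<ge>M. dist (op_of_hs (X m)) (op_of_hs (X n)) < e" by blast
  qed
  then obtain A where A: "(\<lambda>n. op_of_hs (X n)) \<longlonglongrightarrow> A"
    using Cauchy_convergent convergentD by blast
  have close: "\<exists>M. \<forall>n\<ge>M. \<forall>F. finite F \<longrightarrow> F \<subseteq> some_onb \<longrightarrow>
      (\<Sum>e\<in>F. (norm ((op_of_hs (X n) - A) e))\<^sup>2) \<le> r\<^sup>2" if "r > 0" for r
  proof -
    obtain M where M: "\<And>m n. m \<ge> M \<Longrightarrow> n \<ge> M \<Longrightarrow> dist (X m) (X n) < r"
      using metric_CauchyD[OF X] \<open>r > 0\<close> by blast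
    have "(\<Sum>e\<in>F. (norm ((op_of_hs (X n) - A) e))\<^sup>2) \<le> r\<^sup>2"
      if n: "n \<ge> M" and F: "finite F" "F \<subseteq> some_onb" for n F
    proof (rule tendsto_upperbound)
      show "(\<lambda>m. \<Sum>e\<in>F. (norm ((op_of_hs (X n) - op_of_hs (X m)) e))\<^sup>2)
          \<longlonglongrightarrow> (\<Sum>e\<in>F. (norm ((op_of_hs (X n) - A) e))\<^sup>2)"
        by (intro tendsto_intros A)
      have "(\<Sum>e\<in>F. (norm ((op_of_hs (X n) - op_of_hs (X m)) e))\<^sup>2) \<le> r\<^sup>2" if "m \<ge> M" for m
      proof -
        have "(\<Sum>e\<in>F. (norm ((op_of_hs (X n) - op_of_hs (X m)) e))\<^sup>2) \<le> (norm (X n - X m))\<^sup>2"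
          using sum_le_norm_hs[OF F, of "X n - X m"] by (simp add: minus_hs.rep_eq)
        also have "\<dots> \<le> r\<^sup>2"
          using M[OF n that] by (intro power_mono) (auto simp: dist_norm)
        finally show ?thesis .
      qed
      then show "\<forall>\<^sub>F m in sequentially.
          (\<Sum>e\<in>F. (norm ((op_of_hs (X n) - op_of_hs (X m)) e))\<^sup>2) \<le> r\<^sup>2"
        by (auto simp: eventually_sequentially)
    qed simp
    then show ?thesis by blast
  qed
  obtain M where "\<forall>F. finite F \<longrightarrow> F \<subseteq> some_onb \<longrightarrow>
      (\<Sum>e\<in>F. (norm ((op_of_hs (X M) - A) e))\<^sup>2) \<le> 1\<^sup>2"
    using close[of 1] by auto
  then have "hilbert_schmidt (op_of_hs (X M) - A)"
    by (intro hilbert_schmidtI) auto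
  then have "hilbert_schmidt (op_of_hs (X M) - (op_of_hs (X M) - A))"
    by (rule hilbert_schmidt_diff[rotated]) (use op_of_hs[of "X M"] in simp)
  then have hsA: "op_of_hs (Abs_hs A) = A"
    by (simp add: Abs_hs_inverse)
  have "X \<longlonglongrightarrow> Abs_hs A"
  proof (rule metric_LIMSEQ_I)
    fix r :: real assume "r > 0"
    then obtain M where M: "\<forall>n\<ge>M. \<forall>F. finite F \<longrightarrow> F \<subseteq> some_onb \<longrightarrow>
        (\<Sum>e\<in>F. (norm ((op_of_hs (X n) - A) e))\<^sup>2) \<le> (r/2)\<^sup>2"
      using close[of "r/2"] by auto
    have "dist (X n) (Abs_hs A) < r" if "n \<ge> M" for n
    proof -
      have "norm (X n - Abs_hs A) \<le> r/2"
        by (rule norm_hs_leI) (use M that \<open>r > 0\<close> in \<open>auto simp: minus_hs.rep_eq hsA\<close>)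
      then show ?thesis using \<open>r > 0\<close> by (simp add: dist_norm)
    qed
    then show "\<exists>M. \<forall>n\<ge>M. dist (X n) (Abs_hs A) < r" by blast
  qed
  then show "convergent X" by (rule convergentI)
qed

lemma finite_rank_apply:
  fixes F :: "'a::separable_hilbert_space set" and g :: "'a \<Rightarrow> 'a"
  assumes "finite F" "F \<subseteq> some_onb" "e \<in> some_onb"
  shows "blinfun_apply (\<Sum>f\<in>F. blinfun_scaleR_left (g f) o\<^sub>L blinfun_inner_left f) e
    = (if e \<in> F then g e else 0)"
proof -
  have "blinfun_apply (\<Sum>f\<in>F. blinfun_scaleR_left (g f) o\<^sub>L blinfun_inner_left f) e
      = (\<Sum>f\<in>F. (f \<bullet> e) *\<^sub>R g f)"
    by (simp add: blinfun.sum_left inner_commute)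
  also have "\<dots> = (\<Sum>f\<in>F. if e = f then g f else 0)"
  proof (rule sum.cong)
    fix f assume "f \<in> F"
    then show "(f \<bullet> e) *\<^sub>R g f = (if e = f then g f else 0)"
      using some_onb_inner[of f e] assms(2,3) by auto
  qed simp
  finally show ?thesis using assms(1) by simp
qed

instance hs :: (separable_hilbert_space) separable_hilbert_space
proof
  let ?B = "some_onb :: 'a set"
  define T where "T = (\<lambda>F (g :: 'a \<Rightarrow> 'a).
      \<Sum>f\<in>F. blinfun_scaleR_left (g f) o\<^sub>L blinfun_inner_left f)"
  have T: "T F g e = (if e \<in> F then g e else 0)"
    if "finite F" "F \<subseteq> ?B" "e \<in> ?B" for F g e
    unfolding T_def using that by (rule finite_rank_apply)
  have hsT: "op_of_hs (Abs_hs (T F g)) = T F g" if F: "finite F" "F \<subseteq> ?B" for F g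
  proof -
    have "hilbert_schmidt (T F g)"
    proof (rule hilbert_schmidtI)
      fix G assume G: "finite G" "G \<subseteq> ?B"
      have "(\<Sum>e\<in>G. (norm (T F g e))\<^sup>2) = (\<Sum>e\<in>G \<inter> F. (norm (g e))\<^sup>2)"
        by (rule sum.mono_neutral_cong_right)
          (use F G in \<open>auto simp: T subset_iff\<close>)
      also have "\<dots> \<le> (\<Sum>e\<in>F. (norm (g e))\<^sup>2)"
        using F by (intro sum_mono2) auto
      finally show "(\<Sum>e\<in>G. (norm (T F g e))\<^sup>2) \<le> (\<Sum>e\<in>F. (norm (g e))\<^sup>2)" .
    qed
    then show ?thesis by (simp add: Abs_hs_inverse)
  qed
  obtain D :: "'a set" where D: "countable D" "\<And>X. open X \<Longrightarrow> X \<noteq> {} \<Longrightarrow> \<exists>d\<in>D. d \<in> X"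
    using countable_dense_setE by blast
  define S where "S = (\<lambda>(F, g). Abs_hs (T F g)) `
      (SIGMA F:{F. finite F \<and> F \<subseteq> ?B}. Pi\<^sub>E F (\<lambda>_. D))"
  have "countable S"
    unfolding S_def
    using D(1) countable_Collect_finite_subset[OF countable_some_onb[where 'a='a]]
    by (intro countable_image countable_SIGMA) (auto intro!: countable_PiE)
  have dense: "\<exists>C\<in>S. dist C A < r" if "r > 0" for A :: "'a hs" and r
  proof -
    let ?a = "\<lambda>e. (norm (op_of_hs A e))\<^sup>2"
    have sA: "?a summable_on ?B"
      using op_of_hs[of A] by (intro hilbert_schmidt_summable) simp
    have "\<exists>F. finite F \<and> F \<subseteq> ?B \<and> infsum ?a ?B - r\<^sup>2/4 < sum ?a F"
    proof (rule ccontr)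
      assume "\<not> ?thesis"
      then have "infsum ?a ?B \<le> infsum ?a ?B - r\<^sup>2/4"
        by (intro infsum_le_finite_sums[OF sA]) (auto simp: not_less)
      then show False using \<open>r > 0\<close> by simp
    qed
    then obtain F where F: "finite F" "F \<subseteq> ?B" "infsum ?a ?B - r\<^sup>2/4 < sum ?a F"
      by blast
    define \<delta> where "\<delta> = r / (2 * sqrt (real (card F) + 1))"
    have "\<delta> > 0" using \<open>r > 0\<close> by (auto simp: \<delta>_def intro!: divide_pos_pos add_nonneg_pos)
    have \<delta>: "real (card F) * \<delta>\<^sup>2 \<le> r\<^sup>2/4"
      by (simp add: \<delta>_def power_divide power_mult_distrib field_simps)
    have "\<exists>d\<in>D. dist (op_of_hs A e) d < \<delta>" for e
      using D(2)[of "ball (op_of_hs A e) \<delta>"] \<open>\<delta> > 0\<close> by auto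
    then obtain g0 where g0: "\<And>e. g0 e \<in> D" "\<And>e. dist (op_of_hs A e) (g0 e) < \<delta>"
      by metis
    define g where "g = restrict g0 F"
    have "Abs_hs (T F g) \<in> S"
      using F g0(1) unfolding S_def g_def by (intro image_eqI[of _ _ "(F, restrict g0 F)"]) auto
    moreover have "norm (Abs_hs (T F g) - A) \<le> 3/4 * r"
    proof (rule norm_hs_leI)
      fix G assume G: "finite G" "G \<subseteq> ?B"
      let ?n = "\<lambda>e. (norm (op_of_hs (Abs_hs (T F g) - A) e))\<^sup>2"
      have n: "?n e = (norm ((if e \<in> F then g0 e else 0) - op_of_hs A e))\<^sup>2" if "e \<in> ?B" for e
        using that F by (simp add: minus_hs.rep_eq hsT T blinfun.diff_left g_def)
      have "sum ?n G = sum ?n (G \<inter> F) + sum ?n (G - F)"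
        using G by (subst sum.Int_Diff[of _ _ F]) auto
      also have "sum ?n (G \<inter> F) \<le> (\<Sum>e\<in>F. \<delta>\<^sup>2)"
      proof (rule sum_le_included[where i=id])
        have "?n e \<le> \<delta>\<^sup>2" if "e \<in> F" for e
          using g0(2)[of e] that F
          by (subst n) (auto simp: dist_norm norm_minus_commute intro!: power_mono)
        then show "\<forall>s\<in>G \<inter> F. \<exists>y\<in>F. id y = s \<and> ?n s \<le> \<delta>\<^sup>2" by auto
      qed (use F G in auto)
      also have "sum ?n (G - F) = sum ?a (G - F)"
        by (rule sum.cong) (use G n in auto)
      also have "\<dots> \<le> r\<^sup>2/4"
      proof -
        have "sum ?a (G - F) + sum ?a F = sum ?a ((G - F) \<union> F)"
          using F G by (subst sum.union_disjoint) auto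
        also have "\<dots> \<le> infsum ?a ?B"
          using F G by (intro finite_sum_le_infsum[OF sA]) auto
        finally show ?thesis using F(3) by simp
      qed
      finally have "sum ?n G \<le> r\<^sup>2/4 + r\<^sup>2/4"
        using \<delta> by simp
      also have "\<dots> \<le> (3/4 * r)\<^sup>2"
        by (simp add: power_mult_distrib power2_eq_square)
      finally show "sum ?n G \<le> (3/4 * r)\<^sup>2" .
    qed (use \<open>r > 0\<close> in simp)
    ultimately show ?thesis
      using \<open>r > 0\<close> by (intro bexI[of _ "Abs_hs (T F g)"]) (auto simp: dist_norm)
  qed
  define \<B> where "\<B> = (\<lambda>(C, k). ball C (inverse (real (Suc k)))) ` (S \<times> UNIV)"
  have "topological_basis \<B>"
  proof (rule topological_basisI)
    fix U and A :: "'a hs" assume "open U" "A \<in> U"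
    then obtain r where r: "r > 0" "ball A r \<subseteq> U"
      by (meson openE)
    then obtain k where k: "inverse (real (Suc k)) < r / 2"
      using reals_Archimedean[of "r/2"] by auto
    then obtain C where C: "C \<in> S" "dist C A < inverse (real (Suc k))"
      using dense[of "inverse (real (Suc k))" A] by auto
    have "ball C (inverse (real (Suc k))) \<subseteq> ball A r"
    proof
      fix x assume "x \<in> ball C (inverse (real (Suc k)))"
      then show "x \<in> ball A r"
        using dist_triangle[of A x C] C(2) k by (simp add: dist_commute)
    qed
    then show "\<exists>B'\<in>\<B>. A \<in> B' \<and> B' \<subseteq> U"
      using C r by (intro bexI[of _ "ball C (inverse (real (Suc k)))"]) (auto simp: \<B>_def)
  qed (auto simp: \<B>_def)
  moreover have "countable \<B>"
    unfolding \<B>_def using \<open>countable S\<close> by (intro countable_image countable_SIGMA) auto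
  ultimately show "\<exists>\<B>::'a hs set set. countable \<B> \<and> open = generate_topology \<B>"
    using topological_basis_imp_subbasis by blast
qed

section \<open>Square roots and trace class operators\<close>

definition nonneg_definite :: "('a::real_inner \<Rightarrow>\<^sub>L 'a) \<Rightarrow> bool" where
  "nonneg_definite A \<longleftrightarrow>
     (\<forall>x y. blinfun_apply A x \<bullet> y = x \<bullet> blinfun_apply A y) \<and> (\<forall>x. 0 \<le> blinfun_apply A x \<bullet> x)"

definition op_sqrt :: "('a::real_inner \<Rightarrow>\<^sub>L 'a) \<Rightarrow> ('a \<Rightarrow>\<^sub>L 'a)" where
  "op_sqrt A = (THE B. nonneg_definite B \<and> B o\<^sub>L B = A)"

definition op_adjoint :: "('a::real_inner \<Rightarrow>\<^sub>L 'a) \<Rightarrow> ('a \<Rightarrow>\<^sub>L 'a)" where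
  "op_adjoint A = Blinfun (adjoint (blinfun_apply A))"

definition trace_norm :: "('a::real_inner \<Rightarrow>\<^sub>L 'a) \<Rightarrow> ennreal" where
  "trace_norm A = hs_norm_sq (op_sqrt (op_sqrt (op_adjoint A o\<^sub>L A)))"

definition compact_operator :: "('a::real_normed_vector \<Rightarrow>\<^sub>L 'a) \<Rightarrow> bool" where
  "compact_operator A \<longleftrightarrow> compact (closure (blinfun_apply A ` cball 0 1))"

definition trace_class :: "('a::real_inner \<Rightarrow>\<^sub>L 'a) \<Rightarrow> bool" where
  "trace_class A \<longleftrightarrow> compact_operator A \<and> trace_norm A < \<infinity>"

text \<open>Trace class operators are Hilbert--Schmidt, so the trace class operators are represented by
  a subspace of \<^typ>\<open>'a hs\<close> and an operator on \<^typ>\<open>'a hs\<close> is restricted to it.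
  The second definition is the operator norm of that restriction with respect to the trace norm,
  in the form of \<^const>\<open>onorm\<close> (the junk value \<open>0 / 0 = 0\<close> is harmless).\<close>

definition bounded_on_trace_class ::
    "('a::separable_hilbert_space hs \<Rightarrow>\<^sub>L 'a hs) \<Rightarrow> bool" where
  "bounded_on_trace_class C \<longleftrightarrow>
     (\<forall>A. trace_class (op_of_hs A) \<longrightarrow> trace_class (op_of_hs (blinfun_apply C A))) \<and>
     (\<exists>K. \<forall>A. trace_class (op_of_hs A) \<longrightarrow>
        trace_norm (op_of_hs (blinfun_apply C A)) \<le> ennreal K * trace_norm (op_of_hs A))"

definition trace_onorm :: "('a::separable_hilbert_space hs \<Rightarrow>\<^sub>L 'a hs) \<Rightarrow> real" where
  "trace_onorm C = (SUP A\<in>{A. trace_class (op_of_hs A)}.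
     enn2real (trace_norm (op_of_hs (blinfun_apply C A))) / enn2real (trace_norm (op_of_hs A)))"

section \<open>Variance processes driven by compound Poisson processes\<close>

definition poisson_process :: "'w measure \<Rightarrow> real \<Rightarrow> (real \<Rightarrow> 'w \<Rightarrow> nat) \<Rightarrow> bool" where
  "poisson_process M r N \<longleftrightarrow>
     0 < r \<and>
     (\<forall>t\<ge>0. N t \<in> measurable M (count_space UNIV)) \<and>
     (AE \<omega> in M. N 0 \<omega> = 0 \<and> mono_on {0..} (\<lambda>t. N t \<omega>) \<and>
        (\<forall>t\<ge>0. continuous (at_right t) (\<lambda>s. N s \<omega>))) \<and>
     (\<forall>s t. 0 \<le> s \<and> s < t \<longrightarrow>
        distr M (count_space UNIV) (\<lambda>\<omega>. N t \<omega> - N s \<omega>)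
          = measure_pmf (poisson_pmf (r * (t - s)))) \<and>
     (\<forall>\<tau> :: nat \<Rightarrow> real. 0 \<le> \<tau> 0 \<and> mono \<tau> \<longrightarrow>
        prob_space.indep_vars M (\<lambda>_. count_space UNIV)
          (\<lambda>j \<omega>. N (\<tau> (Suc j)) \<omega> - N (\<tau> j) \<omega>) UNIV)"

text \<open>Independence of two random elements with values in spaces of different types
  (\<^const>\<open>prob_space.indep_var\<close> requires a common type).\<close>

definition indep_elements ::
    "'w measure \<Rightarrow> 'b measure \<Rightarrow> ('w \<Rightarrow> 'b) \<Rightarrow> 'c measure \<Rightarrow> ('w \<Rightarrow> 'c) \<Rightarrow> bool" where
  "indep_elements M MX X MY Y \<longleftrightarrow>
     X \<in> measurable M MX \<and> Y \<in> measurable M MY \<and>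
     prob_space.indep_set M (sets (vimage_algebra (space M) X MX))
       (sets (vimage_algebra (space M) Y MY))"

text \<open>Sequences of jump sizes are indexed from 1.\<close>

definition iid_sequence :: "'w measure \<Rightarrow> (nat \<Rightarrow> 'w \<Rightarrow> 'b::topological_space) \<Rightarrow> bool" where
  "iid_sequence M X \<longleftrightarrow>
     prob_space.indep_vars M (\<lambda>_. borel) X {1..} \<and>
     (\<forall>i\<ge>1. distr M borel (X i) = distr M borel (X 1))"

definition compound_process ::
    "(real \<Rightarrow> 'w \<Rightarrow> nat) \<Rightarrow> (nat \<Rightarrow> 'w \<Rightarrow> 'b::comm_monoid_add) \<Rightarrow> real \<Rightarrow> 'w \<Rightarrow> 'b" where
  "compound_process N X t \<omega> = (\<Sum>i = 1..N t \<omega>. X i \<omega>)"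

text \<open>The equation \<open>dV(t) = C V(t) dt + dL(t)\<close>, \<open>V(0) = V0\<close> in integrated form, for a process
  \<open>L\<close> with \<open>L(0) = 0\<close>. The integral is pathwise. If \<open>L\<close> has step functions as paths, then the
  paths of \<open>V\<close> are sums of a continuous function and a step function, so the Bochner and the
  Henstock--Kurzweil integral agree.\<close>

definition solves_linear_sde ::
    "'w measure \<Rightarrow> ('b::{banach, second_countable_topology} \<Rightarrow>\<^sub>L 'b) \<Rightarrow> ('w \<Rightarrow> 'b) \<Rightarrow>
       (real \<Rightarrow> 'w \<Rightarrow> 'b) \<Rightarrow> (real \<Rightarrow> 'w \<Rightarrow> 'b) \<Rightarrow> bool" where
  "solves_linear_sde M C V0 L V \<longleftrightarrow>
     (\<forall>t\<ge>0. V t \<in> borel_measurable M) \<and>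
     (AE \<omega> in M. V 0 \<omega> = V0 \<omega> \<and>
        (\<forall>t\<ge>0. (\<lambda>s. blinfun_apply C (V s \<omega>)) integrable_on {0..t} \<and>
           V t \<omega> = V0 \<omega> + integral {0..t} (\<lambda>s. blinfun_apply C (V s \<omega>)) + L t \<omega>))"

end

theory Submission
  imports Defs
begin

text \<open>Pathwise, \<open>D = V - V\<^sup>n\<close> solves the linear equation driven by the compound Poisson process with
  jumps \<open>X\<^sub>i - X\<^sub>i\<^sup>n\<close>, hence
  \<open>\<parallel>D(t)\<parallel>\<^sub>1 \<le> e\<^bsup>\<parallel>C\<parallel>T\<^esup> (\<Sum>i\<le>N(T). \<parallel>X\<^sub>i - X\<^sub>i\<^sup>n\<parallel>\<^sub>1)\<close> for \<open>t \<le> T\<close>. The Powers--Stormer inequality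
  \<open>\<parallel>\<surd>A - \<surd>B\<parallel>\<^sup>2 \<le> \<parallel>A - B\<parallel>\<^sub>1\<close>, with the Hilbert--Schmidt norm on the left, turns this into a bound for
  the square roots, and Wald's identity gives the expectation of the right-hand side because \<open>N\<close> is
  independent of the jumps. The constant is \<open>k = 1\<close>.\<close>

section \<open>Orthonormal bases\<close>

text \<open>The trace norm is defined through a fourth root, from which not even the triangle
  inequality can be read off. It is therefore rewritten as a supremum of pairings with
  Hilbert-Schmidt operators of operator norm at most 1. All limits and integrals are taken in
  Hilbert-Schmidt norm, where each pairing is continuous while the trace norm in general is not.

  Square roots and adjoints are given by description operators and say nothing until existence, and
  for roots uniqueness, is known. The operators whose roots are taken are compact, so a basis of
  eigenvectors settles this and reduces the computations to scalars. Working in such bases requires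
  the Hilbert-Schmidt norm to be independent of the basis.

  The pathwise bound holds for all times at once outside a null set, and its right side is a
  measurable random sum. Monotonicity of the integral then handles the supremum over uncountably
  many times. The factor \<lambda> T is the mean of N(T).\<close>

lemma norm_sum_orthogonal:
  fixes g :: "'i \<Rightarrow> 'a::real_inner"
  assumes "finite F" "\<And>i j. i \<in> F \<Longrightarrow> j \<in> F \<Longrightarrow> i \<noteq> j \<Longrightarrow> g i \<bullet> g j = 0"
  shows "(norm (sum g F))\<^sup>2 = (\<Sum>i\<in>F. (norm (g i))\<^sup>2)"
proof -
  have "(norm (sum g F))\<^sup>2 = (\<Sum>i\<in>F. \<Sum>j\<in>F. g i \<bullet> g j)"
    by (subst sum.swap) (simp add: power2_norm_eq_inner inner_sum_left inner_sum_right)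
  also have "\<dots> = (\<Sum>i\<in>F. \<Sum>j\<in>F. if i = j then g i \<bullet> g i else 0)"
    by (intro sum.cong refl) (use assms in auto)
  finally show ?thesis
    using assms(1) by (simp add: power2_norm_eq_inner)
qed

text \<open>Square summability suffices in place of absolute summability: by Pythagoras a finite sum
  that avoids \<open>F0\<close> is controlled by the tail of the squares, so the net of finite sums
  is Cauchy.\<close>

lemma summable_on_orthogonal:
  fixes g :: "'i \<Rightarrow> 'a::{real_inner, banach}"
  assumes orth: "\<And>i j. i \<in> A \<Longrightarrow> j \<in> A \<Longrightarrow> i \<noteq> j \<Longrightarrow> g i \<bullet> g j = 0"
    and sq: "(\<lambda>i. (norm (g i))\<^sup>2) summable_on A"
  shows "g summable_on A"
proof -
  let ?q = "\<lambda>i. (norm (g i))\<^sup>2"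
  have "\<exists>P. eventually P (finite_subsets_at_top A) \<and>
      (\<forall>F F'. P F \<and> P F' \<longrightarrow> dist (sum g F) (sum g F') < r)" if "r > 0" for r :: real
  proof -
    obtain F0 where F0: "finite F0" "F0 \<subseteq> A" "infsum ?q A - (r/3)\<^sup>2 < sum ?q F0"
    proof (rule ccontr)
      assume "\<not> thesis"
      then have "infsum ?q A \<le> infsum ?q A - (r/3)\<^sup>2"
        using that by (intro infsum_le_finite_sums[OF sq]) (auto simp: not_less[symmetric])
      then show False using \<open>r > 0\<close> by simp
    qed
    have small: "norm (sum g G) \<le> r/3" if G: "finite G" "G \<subseteq> A" "G \<inter> F0 = {}" for G
    proof -
      have "sum ?q G + sum ?q F0 = sum ?q (G \<union> F0)"
        using G F0 by (simp add: sum.union_disjoint)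
      also have "\<dots> \<le> infsum ?q A"
        using G F0 by (intro finite_sum_le_infsum[OF sq]) auto
      finally have "(norm (sum g G))\<^sup>2 \<le> (r/3)\<^sup>2"
        using F0(3) by (subst norm_sum_orthogonal) (use G orth in \<open>auto simp: subset_iff\<close>)
      then show ?thesis using \<open>r > 0\<close> by (simp add: power2_le_iff_abs_le)
    qed
    let ?P = "\<lambda>F. finite F \<and> F0 \<subseteq> F \<and> F \<subseteq> A"
    have "dist (sum g F) (sum g F') < r" if "?P F" "?P F'" for F F'
    proof -
      \<comment> \<open>Both sets contain \<open>F0\<close>, so their two differences avoid it and
        \<open>small\<close> applies.\<close>
      have "sum g F - sum g F' = sum g (F - F') - sum g (F' - F)"
        using that sum.Int_Diff[of F g F'] sum.Int_Diff[of F' g F] by (simp add: Int_commute)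
      then have "dist (sum g F) (sum g F') \<le> norm (sum g (F - F')) + norm (sum g (F' - F))"
        by (simp add: dist_norm norm_triangle_ineq4)
      also have "\<dots> \<le> r/3 + r/3"
        using that by (intro add_mono small) auto
      finally show ?thesis using \<open>r > 0\<close> by simp
    qed
    moreover have "eventually ?P (finite_subsets_at_top A)"
      using F0 by (auto simp: eventually_finite_subsets_at_top)
    ultimately show ?thesis by (intro exI[of _ ?P] conjI allI impI) auto
  qed
  then have "cauchy_filter (filtermap (sum g) (finite_subsets_at_top A))"
    by (simp add: cauchy_filter_metric_filtermap)
  then obtain L where "(sum g \<longlongrightarrow> L) (finite_subsets_at_top A)"
    using complete_uniform[where S="UNIV :: 'a set"] complete_UNIV_cuspace by (force simp add: filterlim_def)
  then show ?thesis
    using summable_on_def has_sum_def by blast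
qed

lemma has_sum_norm_orthogonal:
  fixes g :: "'i \<Rightarrow> 'a::real_inner"
  assumes orth: "\<And>i j. i \<in> A \<Longrightarrow> j \<in> A \<Longrightarrow> i \<noteq> j \<Longrightarrow> g i \<bullet> g j = 0"
    and g: "(g has_sum x) A"
  shows "((\<lambda>i. (norm (g i))\<^sup>2) has_sum (norm x)\<^sup>2) A"
proof -
  have "((\<lambda>F. (norm (sum g F))\<^sup>2) \<longlongrightarrow> (norm x)\<^sup>2) (finite_subsets_at_top A)"
    using g unfolding has_sum_def by (intro tendsto_intros)
  moreover have "eventually (\<lambda>F. (norm (sum g F))\<^sup>2 = (\<Sum>i\<in>F. (norm (g i))\<^sup>2)) (finite_subsets_at_top A)"
    by (rule eventually_finite_subsets_at_top_weakI, rule norm_sum_orthogonal) (use orth in auto)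
  ultimately show ?thesis
    unfolding has_sum_def using tendsto_cong by fastforce
qed

text \<open>Split off from \<open>is_onb\<close> because Zorn's lemma will produce orthonormal sets
  of eigenvectors whose span is shown to be dense only afterwards.\<close>

definition orthonormal :: "'a::real_inner set \<Rightarrow> bool" where
  "orthonormal B \<longleftrightarrow> (\<forall>e\<in>B. \<forall>f\<in>B. e \<bullet> f = (if e = f then 1 else 0))"

lemma is_onb_iff: "is_onb B \<longleftrightarrow> orthonormal B \<and> closure (span B) = UNIV"
  unfolding is_onb_def orthonormal_def pairwise_def orthogonal_def
  by (auto simp: norm_eq_1)

lemma is_onb_orthonormal: "is_onb B \<Longrightarrow> orthonormal B"
  by (simp add: is_onb_iff)

lemma is_onb_norm: "is_onb B \<Longrightarrow> e \<in> B \<Longrightarrow> norm e = 1"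
  by (simp add: is_onb_def)

section \<open>Expansions in orthonormal sets\<close>

lemma bessel_finite:
  assumes "orthonormal B" "finite F" "F \<subseteq> B"
  shows "(\<Sum>e\<in>F. (x \<bullet> e)\<^sup>2) \<le> (norm x)\<^sup>2"
proof -
  let ?y = "\<Sum>e\<in>F. (x \<bullet> e) *\<^sub>R e"
  have ny: "(norm ?y)\<^sup>2 = (\<Sum>e\<in>F. (x \<bullet> e)\<^sup>2)"
    by (subst norm_sum_orthogonal)
      (use assms in \<open>auto simp: orthonormal_def subset_iff power_mult_distrib
        power2_norm_eq_inner intro!: sum.cong\<close>)
  have xy: "x \<bullet> ?y = (\<Sum>e\<in>F. (x \<bullet> e)\<^sup>2)"
    by (simp add: inner_sum_right power2_eq_square)
  have "0 \<le> (norm (x - ?y))\<^sup>2" by simp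
  also have "\<dots> = (norm x)\<^sup>2 - (\<Sum>e\<in>F. (x \<bullet> e)\<^sup>2)"
    using ny xy unfolding power2_norm_eq_inner
    by (simp add: inner_diff_left inner_diff_right inner_commute)
  finally show ?thesis by simp
qed

lemma orthonormal_summable:
  fixes B :: "'a::{real_inner, banach} set"
  assumes "orthonormal B"
  shows "(\<lambda>e. (x \<bullet> e)\<^sup>2) summable_on B" "(\<lambda>e. (x \<bullet> e) *\<^sub>R e) summable_on B"
proof -
  show *: "(\<lambda>e. (x \<bullet> e)\<^sup>2) summable_on B"
    by (rule nonneg_bdd_above_summable_on)
      (auto intro!: bdd_aboveI[of _ "(norm x)\<^sup>2"] bessel_finite[OF assms])
  have "(\<lambda>e. (norm ((x \<bullet> e) *\<^sub>R e))\<^sup>2) summable_on B \<longleftrightarrow> (\<lambda>e. (x \<bullet> e)\<^sup>2) summable_on B"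
    by (rule summable_on_cong)
      (use assms in \<open>auto simp: orthonormal_def power_mult_distrib power2_norm_eq_inner\<close>)
  with * have sq: "(\<lambda>e. (norm ((x \<bullet> e) *\<^sub>R e))\<^sup>2) summable_on B" by blast
  show "(\<lambda>e. (x \<bullet> e) *\<^sub>R e) summable_on B"
    by (rule summable_on_orthogonal[OF _ sq]) (use assms in \<open>simp add: orthonormal_def\<close>)
qed

lemma has_sum_in_closure_span:
  fixes g :: "'i \<Rightarrow> 'a::real_normed_vector"
  assumes "(g has_sum x) A" "\<And>i. i \<in> A \<Longrightarrow> g i \<in> span S"
  shows "x \<in> closure (span S)"
proof -
  have "\<forall>\<^sub>F F in finite_subsets_at_top A. sum g F \<in> closure (span S)"
    by (rule eventually_finite_subsets_at_top_weakI)
      (use assms(2) in \<open>auto intro!: subsetD[OF closure_subset] span_sum\<close>)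
  then show ?thesis
    by (rule Lim_in_closed_set[OF closed_closure])
      (use assms(1) in \<open>auto simp: has_sum_def\<close>)
qed

lemma orthonormal_expansion_residual:
  fixes B :: "'a::{real_inner, banach} set"
  assumes B: "orthonormal B" and y: "((\<lambda>e. (x \<bullet> e) *\<^sub>R e) has_sum y) B" and f: "f \<in> B"
  shows "(x - y) \<bullet> f = 0"
proof -
  have "((\<lambda>e. ((x \<bullet> e) *\<^sub>R e) \<bullet> f) has_sum (y \<bullet> f)) B"
    by (rule has_sum_bounded_linear[OF bounded_linear_inner_left y])
  moreover have "((\<lambda>e. ((x \<bullet> e) *\<^sub>R e) \<bullet> f) has_sum (x \<bullet> f)) B"
    by (rule has_sum_finite_neutralI[where B="{f}"]) (use B f in \<open>auto simp: orthonormal_def\<close>)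
  ultimately have "y \<bullet> f = x \<bullet> f" by (rule has_sum_unique)
  then show ?thesis by (simp add: inner_diff_left)
qed

lemma is_onb_total:
  assumes "is_onb B" "\<And>e. e \<in> B \<Longrightarrow> x \<bullet> e = 0"
  shows "x = 0"
proof -
  have "span B \<subseteq> {y. x \<bullet> y = 0}"
    by (rule span_minimal) (use assms(2) in \<open>auto simp: subspace_def inner_add_right\<close>)
  moreover have "closed {y. x \<bullet> y = 0}"
    by (intro closed_Collect_eq continuous_intros)
  ultimately have "closure (span B) \<subseteq> {y. x \<bullet> y = 0}"
    by (rule closure_minimal)
  moreover have "x \<in> closure (span B)" using assms(1) by (simp add: is_onb_def)
  ultimately have "x \<in> {y. x \<bullet> y = 0}" by blast
  then show ?thesis by simp
qed

lemma orthonormal_total_expansion: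
  fixes B :: "'a::{real_inner, banach} set"
  assumes B: "orthonormal B" and total: "\<And>x. (\<And>e. e \<in> B \<Longrightarrow> x \<bullet> e = 0) \<Longrightarrow> x = 0"
  shows "((\<lambda>e. (x \<bullet> e) *\<^sub>R e) has_sum x) B"
proof -
  obtain y where y: "((\<lambda>e. (x \<bullet> e) *\<^sub>R e) has_sum y) B"
    using orthonormal_summable(2)[OF B] by (auto simp: summable_on_def)
  then have "x - y = 0"
    using total orthonormal_expansion_residual[OF B] by blast
  with y show ?thesis by simp
qed

text \<open>A maximality argument delivers totality, not a dense span; the convergent expansion
  leads from one to the other.\<close>

lemma is_onbI_total:
  fixes B :: "'a::{real_inner, banach} set"
  assumes "orthonormal B" "\<And>x. (\<And>e. e \<in> B \<Longrightarrow> x \<bullet> e = 0) \<Longrightarrow> x = 0"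
  shows "is_onb B"
proof -
  have "x \<in> closure (span B)" for x
    by (rule has_sum_in_closure_span[OF orthonormal_total_expansion[OF assms]])
      (auto intro: span_scale span_base)
  then show ?thesis using assms(1) by (auto simp: is_onb_iff)
qed

lemma onb_expansion:
  fixes B :: "'a::{real_inner, banach} set"
  assumes "is_onb B"
  shows "((\<lambda>e. (x \<bullet> e) *\<^sub>R e) has_sum x) B"
  by (rule orthonormal_total_expansion) (use assms is_onb_total is_onb_orthonormal in auto)

lemma onb_expansion_blinfun:
  fixes B :: "'a::{real_inner, banach} set" and A :: "'a \<Rightarrow>\<^sub>L 'b::real_normed_vector"
  assumes "is_onb B"
  shows "((\<lambda>e. (x \<bullet> e) *\<^sub>R A e) has_sum A x) B"
  using has_sum_bounded_linear[OF blinfun.bounded_linear_right[of A] onb_expansion[OF assms, of x]]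
  by (simp add: blinfun.scaleR_right)

lemma parseval:
  fixes B :: "'a::{real_inner, banach} set"
  assumes "is_onb B"
  shows "((\<lambda>e. (x \<bullet> e)\<^sup>2) has_sum (norm x)\<^sup>2) B"
proof -
  have "((\<lambda>e. ((x \<bullet> e) *\<^sub>R e) \<bullet> x) has_sum (x \<bullet> x)) B"
    by (rule has_sum_bounded_linear[OF bounded_linear_inner_left onb_expansion[OF assms]])
  then show ?thesis
    by (simp add: power2_norm_eq_inner) (simp add: power2_eq_square inner_commute)
qed

lemma blinfun_eq_on_onb:
  fixes B :: "'a::{real_inner, banach} set" and A A' :: "'a \<Rightarrow>\<^sub>L 'b::real_normed_vector"
  assumes "is_onb B" "\<And>e. e \<in> B \<Longrightarrow> A e = A' e"
  shows "A = A'"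
proof (rule blinfun_eqI)
  fix x
  have "((\<lambda>e. (x \<bullet> e) *\<^sub>R A e) has_sum A' x) B"
    using onb_expansion_blinfun[OF assms(1), of x A'] assms(2) by (simp cong: has_sum_cong)
  then show "A x = A' x"
    using onb_expansion_blinfun[OF assms(1), of x A] has_sum_unique by blast
qed

text \<open>Source of operators with prescribed values on a basis: square roots and the test
  operators of the duality. Bounded images alone would not extend to a bounded operator; their
  orthogonality makes the series converge and, with Parseval, bounds its norm.\<close>

lemma orthogonal_extension:
  fixes B :: "'a::{real_inner, banach} set" and g :: "'a \<Rightarrow> 'a"
  assumes B: "is_onb B" and orth: "\<And>e f. e \<in> B \<Longrightarrow> f \<in> B \<Longrightarrow> e \<noteq> f \<Longrightarrow> g e \<bullet> g f = 0"
    and bound: "\<And>e. e \<in> B \<Longrightarrow> norm (g e) \<le> c" and c: "c \<ge> 0"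
  obtains S :: "'a \<Rightarrow>\<^sub>L 'a" where "\<And>e. e \<in> B \<Longrightarrow> S e = g e" "norm S \<le> c"
proof -
  define s where "s x = (\<Sum>\<^sub>\<infinity>e\<in>B. (x \<bullet> e) *\<^sub>R g e)" for x
  have le: "(norm ((x \<bullet> e) *\<^sub>R g e))\<^sup>2 \<le> c\<^sup>2 * (x \<bullet> e)\<^sup>2" if "e \<in> B" for x e
    using bound[OF that] by (auto simp: power_mult_distrib mult.commute[of "c\<^sup>2"]
        intro!: mult_left_mono power_mono)
  have sq: "(\<lambda>e. c\<^sup>2 * (x \<bullet> e)\<^sup>2) summable_on B" for x
    by (intro summable_on_cmult_right orthonormal_summable is_onb_orthonormal B)
  have sq': "(\<lambda>e. (norm ((x \<bullet> e) *\<^sub>R g e))\<^sup>2) summable_on B" for x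
    by (rule summable_on_comparison_test[OF sq[of x]]) (use le in auto)
  have "(\<lambda>e. (x \<bullet> e) *\<^sub>R g e) summable_on B" for x
    by (rule summable_on_orthogonal[OF _ sq']) (use orth in auto)
  then have s: "((\<lambda>e. (x \<bullet> e) *\<^sub>R g e) has_sum s x) B" for x
    unfolding s_def by simp
  have nrm: "norm (s x) \<le> c * norm x" for x
  proof -
    have "(norm (s x))\<^sup>2 \<le> c\<^sup>2 * (norm x)\<^sup>2"
    proof (rule has_sum_mono[OF has_sum_norm_orthogonal[OF _ s]])
      show "((\<lambda>e. c\<^sup>2 * (x \<bullet> e)\<^sup>2) has_sum c\<^sup>2 * (norm x)\<^sup>2) B"
        by (intro has_sum_cmult_right parseval B)
    qed (use orth le in auto)
    then have "(norm (s x))\<^sup>2 \<le> (c * norm x)\<^sup>2" by (simp add: power_mult_distrib)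
    then show ?thesis by (rule power2_le_imp_le) (use c in simp)
  qed
  have lin: "bounded_linear s"
  proof (rule bounded_linear_intro)
    show "s (x + y) = s x + s y" for x y
      using has_sum_add[OF s[of x] s[of y]] s[of "x + y"]
      by (intro has_sum_unique[where A=B]) (auto simp: inner_add_left scaleR_add_left)
    show "s (r *\<^sub>R x) = r *\<^sub>R s x" for r x
      using has_sum_bounded_linear[OF bounded_linear_scaleR_right s[of x], of r] s[of "r *\<^sub>R x"]
      by (intro has_sum_unique[where A=B]) auto
    show "norm (s x) \<le> norm x * c" for x using nrm[of x] by (simp add: mult.commute)
  qed
  show thesis
  proof (rule that[of "Blinfun s"])
    fix e assume e: "e \<in> B"
    have "((\<lambda>f. (e \<bullet> f) *\<^sub>R g f) has_sum g e) B"
      by (rule has_sum_finite_neutralI[where B="{e}"])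
        (use is_onb_orthonormal[OF B] e in \<open>auto simp: orthonormal_def\<close>)
    then show "blinfun_apply (Blinfun s) e = g e"
      using has_sum_unique[OF s[of e]] by (simp add: bounded_linear_Blinfun_apply[OF lin])
  next
    show "norm (Blinfun s) \<le> c"
      by (rule norm_blinfun_bound[OF c]) (simp add: bounded_linear_Blinfun_apply[OF lin] nrm)
  qed
qed

section \<open>Hilbert--Schmidt operators\<close>

text \<open>The representing vector has to be the series of \<open>\<phi> e *\<^sub>R e\<close>. Its
  coefficients are square summable because testing \<open>\<phi>\<close> on a finite partial sum z
  gives |z|^2 = \<phi>(z) \<le> c |z|.\<close>

lemma riesz_representation:
  fixes \<phi> :: "'a::separable_hilbert_space \<Rightarrow> real"
  assumes "bounded_linear \<phi>"
  obtains z where "\<And>x. \<phi> x = x \<bullet> z"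
proof -
  interpret \<phi>: bounded_linear \<phi> by fact
  let ?B = "some_onb :: 'a set"
  have B: "is_onb ?B" by (rule is_onb_some_onb)
  obtain c where c: "c > 0" "\<And>x. norm (\<phi> x) \<le> norm x * c"
    using \<phi>.pos_bounded by blast
  have "(\<Sum>e\<in>F. (\<phi> e)\<^sup>2) \<le> c\<^sup>2" if F: "finite F" "F \<subseteq> ?B" for F
  proof -
    let ?z = "\<Sum>e\<in>F. \<phi> e *\<^sub>R e" and ?s = "\<Sum>e\<in>F. (\<phi> e)\<^sup>2"
    have nz: "(norm ?z)\<^sup>2 = ?s"
      by (subst norm_sum_orthogonal)
        (use F in \<open>auto simp: some_onb_inner some_onb_norm subset_iff power_mult_distrib intro!: sum.cong\<close>)
    have "?s = \<phi> ?z" by (simp add: \<phi>.sum \<phi>.scaleR power2_eq_square)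
    also have "\<dots> \<le> norm ?z * c" using c(2)[of ?z] by simp
    finally have "(norm ?z)\<^sup>2 \<le> norm ?z * c" using nz by simp
    then have "norm ?z \<le> c"
      using c(1) by (cases "norm ?z = 0") (simp_all add: power2_eq_square)
    then show ?thesis unfolding nz[symmetric] by (intro power_mono) auto
  qed
  then have "(\<lambda>e. (\<phi> e)\<^sup>2) summable_on ?B"
    by (intro nonneg_bdd_above_summable_on) (auto intro!: bdd_aboveI[of _ "c\<^sup>2"])
  then have "(\<lambda>e. (norm (\<phi> e *\<^sub>R e))\<^sup>2) summable_on ?B"
    by (rule summable_on_cong[THEN iffD1, rotated]) (simp add: some_onb_norm)
  then have "(\<lambda>e. \<phi> e *\<^sub>R e) summable_on ?B"
    by (rule summable_on_orthogonal[rotated]) (simp add: some_onb_inner)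
  then obtain z where z: "((\<lambda>e. \<phi> e *\<^sub>R e) has_sum z) ?B"
    by (auto simp: summable_on_def)
  show thesis
  proof (rule that)
    fix x
    have "((\<lambda>e. x \<bullet> (\<phi> e *\<^sub>R e)) has_sum (x \<bullet> z)) ?B"
      by (rule has_sum_bounded_linear[OF bounded_linear_inner_right z])
    moreover have "((\<lambda>e. \<phi> ((x \<bullet> e) *\<^sub>R e)) has_sum \<phi> x) ?B"
      by (rule has_sum_bounded_linear[OF assms onb_expansion[OF B]])
    ultimately show "\<phi> x = x \<bullet> z"
      by (intro has_sum_unique[where A="?B"]) (simp_all add: \<phi>.scaleR mult.commute)
  qed
qed

text \<open>\<open>op_adjoint\<close> wraps a choice in \<open>Blinfun\<close>, so it is meaningful
  only once a bounded linear adjoint is known to exist. Riesz supplies the function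
  \<open>a\<close>, and its bound comes from |a y|^2 = <A (a y), y>.\<close>

lemma op_adjoint:
  fixes A :: "'a::separable_hilbert_space \<Rightarrow>\<^sub>L 'a"
  shows "A x \<bullet> y = x \<bullet> op_adjoint A y"
proof -
  have "\<exists>z. \<forall>x. A x \<bullet> y = x \<bullet> z" for y
    using riesz_representation[of "\<lambda>x. A x \<bullet> y"]
      bounded_linear_compose[OF bounded_linear_inner_left blinfun.bounded_linear_right]
    by metis
  then obtain a where a: "\<And>x y. A x \<bullet> y = x \<bullet> a y" by metis
  have "adjoint (blinfun_apply A) = a"
    by (rule adjoint_unique) (use a in auto)
  moreover have "bounded_linear a"
  proof (rule bounded_linear_intro)
    show "a (y + z) = a y + a z" for y z
      by (rule vector_eq_ldot[THEN iffD1]) (simp add: inner_add_right flip: a)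
    show "a (r *\<^sub>R y) = r *\<^sub>R a y" for r y
      by (rule vector_eq_ldot[THEN iffD1]) (simp flip: a)
    show "norm (a y) \<le> norm y * norm A" for y
    proof -
      have "norm (a y) * norm (a y) = A (a y) \<bullet> y"
        by (simp add: a flip: power2_norm_eq_inner power2_eq_square)
      also have "\<dots> \<le> norm (A (a y)) * norm y" by (rule norm_cauchy_schwarz)
      also have "\<dots> \<le> (norm A * norm (a y)) * norm y"
        by (intro mult_right_mono norm_blinfun) auto
      finally show ?thesis
        by (cases "norm (a y) = 0") (auto simp: mult_ac mult_le_cancel_left)
    qed
  qed
  ultimately show ?thesis
    by (simp add: op_adjoint_def bounded_linear_Blinfun_apply a)
qed

text \<open>Tonelli for the double series of <A e, f>^2: summing over f first gives |A e|^2, summing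
  over e first gives |A' f|^2, both by Parseval.\<close>

lemma has_sum_hs_adjoint:
  fixes A A' :: "'a::{real_inner, banach} \<Rightarrow>\<^sub>L 'a"
  assumes B: "is_onb B" and B': "is_onb B'" and adj: "\<And>x y. A x \<bullet> y = x \<bullet> A' y"
    and S: "((\<lambda>e. (norm (A e))\<^sup>2) has_sum S) B"
  shows "((\<lambda>f. (norm (A' f))\<^sup>2) has_sum S) B'"
proof -
  let ?f = "\<lambda>(e, f). (A e \<bullet> f)\<^sup>2"
  have inner: "((\<lambda>f. ?f (e, f)) has_sum (norm (A e))\<^sup>2) B'" for e
    using parseval[OF B'] by simp
  have "?f summable_on B \<times> B'"
    by (rule summable_on_SigmaI[OF inner]) (use S in \<open>auto simp: summable_on_def\<close>)
  then have "(?f has_sum S) (B \<times> B')"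
    by (intro has_sum_SigmaI[OF inner S])
  then have "((\<lambda>(f, e). (A e \<bullet> f)\<^sup>2) has_sum S) (B' \<times> B)"
    by (subst (asm) has_sum_swap) simp
  moreover have "((\<lambda>e. (case (f, e) of (f, e) \<Rightarrow> (A e \<bullet> f)\<^sup>2)) has_sum (norm (A' f))\<^sup>2) B" for f
    using parseval[OF B, of "A' f"] by (simp add: adj inner_commute[of _ "A' f"])
  ultimately show ?thesis by (rule has_sum_SigmaD)
qed

text \<open>Two passages to the adjoint, the first staying in \<open>B\<close> and the second moving
  to \<open>B'\<close>.\<close>

lemma has_sum_hs_change_basis:
  fixes A :: "'a::separable_hilbert_space \<Rightarrow>\<^sub>L 'a"
  assumes "is_onb B" "is_onb B'" "((\<lambda>e. (norm (A e))\<^sup>2) has_sum S) B"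
  shows "((\<lambda>f. (norm (A f))\<^sup>2) has_sum S) B'"
proof (rule has_sum_hs_adjoint[OF assms(1,2)])
  show "((\<lambda>f. (norm (op_adjoint A f))\<^sup>2) has_sum S) B"
    by (rule has_sum_hs_adjoint[OF assms(1,1) _ assms(3)]) (rule op_adjoint)
  show "op_adjoint A x \<bullet> y = x \<bullet> A y" for x y
    using op_adjoint[of A y x] by (simp add: inner_commute)
qed

section \<open>Nonnegative series with values in \<open>ennreal\<close>\<close>

lemma infsum_ennreal_SUP:
  assumes "\<And>x. x \<in> A \<Longrightarrow> f x \<ge> 0"
  shows "(\<Sum>\<^sub>\<infinity>x\<in>A. ennreal (f x)) = (SUP F\<in>{F. finite F \<and> F \<subseteq> A}. ennreal (sum f F))"
  using assms by (subst nonneg_infsum_complete) (auto intro!: SUP_cong sum_ennreal)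

lemma infsum_ennreal_eq_top_iff:
  fixes f :: "'i \<Rightarrow> real"
  assumes "\<And>x. x \<in> A \<Longrightarrow> f x \<ge> 0"
  shows "(\<Sum>\<^sub>\<infinity>x\<in>A. ennreal (f x)) = \<infinity> \<longleftrightarrow> \<not> f summable_on A"
proof -
  have SUP: "(\<Sum>\<^sub>\<infinity>x\<in>A. ennreal (f x)) = (SUP F\<in>{F. finite F \<and> F \<subseteq> A}. ennreal (sum f F))"
    by (rule infsum_ennreal_SUP) (use assms in auto)
  show ?thesis
  proof
    assume top: "(\<Sum>\<^sub>\<infinity>x\<in>A. ennreal (f x)) = \<infinity>"
    show "\<not> f summable_on A"
    proof
      assume "f summable_on A"
      then have "(\<Sum>\<^sub>\<infinity>x\<in>A. ennreal (f x)) = ennreal (infsum f A)"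
        unfolding SUP using assms by (subst infsum_nonneg_is_SUPREMUM_ennreal) auto
      with top show False by simp
    qed
  next
    assume ns: "\<not> f summable_on A"
    show "(\<Sum>\<^sub>\<infinity>x\<in>A. ennreal (f x)) = \<infinity>"
    proof (rule ccontr)
      assume "(\<Sum>\<^sub>\<infinity>x\<in>A. ennreal (f x)) \<noteq> \<infinity>"
      then obtain c where c: "(\<Sum>\<^sub>\<infinity>x\<in>A. ennreal (f x)) = ennreal c" "c \<ge> 0"
        by (cases "\<Sum>\<^sub>\<infinity>x\<in>A. ennreal (f x)") auto
      have "sum f F \<le> c" if "finite F" "F \<subseteq> A" for F
      proof -
        have "ennreal (sum f F) \<le> ennreal c"
          unfolding c(1)[symmetric] SUP using that by (intro SUP_upper) auto
        then show ?thesis using c by simp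
      qed
      then have "f summable_on A"
        using assms by (intro nonneg_bdd_above_summable_on) (auto intro!: bdd_aboveI[of _ c])
      with ns show False ..
    qed
  qed
qed

lemma infsum_ennreal_has_sum:
  fixes f :: "'i \<Rightarrow> real"
  assumes "\<And>x. x \<in> A \<Longrightarrow> f x \<ge> 0" "(f has_sum S) A"
  shows "(\<Sum>\<^sub>\<infinity>x\<in>A. ennreal (f x)) = ennreal S"
proof -
  have "(\<Sum>\<^sub>\<infinity>x\<in>A. ennreal (f x)) = (SUP F\<in>{F. finite F \<and> F \<subseteq> A}. ennreal (sum f F))"
    by (rule infsum_ennreal_SUP) (use assms in auto)
  also have "\<dots> = ennreal (infsum f A)"
    using assms by (subst infsum_nonneg_is_SUPREMUM_ennreal) (auto simp: summable_on_def)
  finally show ?thesis using assms(2) by (simp add: infsumI)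
qed

text \<open>Frees \<open>hs_norm_sq\<close> from the basis chosen in its definition, also when the
  value is infinite, so that an operator can be examined in an eigenbasis.\<close>

lemma hs_norm_sq_onb:
  fixes A :: "'a::separable_hilbert_space \<Rightarrow>\<^sub>L 'a"
  assumes B: "is_onb B"
  shows "hs_norm_sq A = (\<Sum>\<^sub>\<infinity>e\<in>B. ennreal ((norm (A e))\<^sup>2))"
proof (cases "(\<lambda>e. (norm (A e))\<^sup>2) summable_on B")
  case True
  then obtain S where S: "((\<lambda>e. (norm (A e))\<^sup>2) has_sum S) B" by (auto simp: summable_on_def)
  then show ?thesis
    using has_sum_hs_change_basis[OF B is_onb_some_onb S]
    by (simp add: hs_norm_sq_def infsum_ennreal_has_sum)
next
  case False
  then have "\<not> (\<lambda>e. (norm (A e))\<^sup>2) summable_on some_onb"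
    using has_sum_hs_change_basis[OF is_onb_some_onb B] by (auto simp: summable_on_def)
  with False show ?thesis
    unfolding hs_norm_sq_def by (simp flip: infsum_ennreal_eq_top_iff)
qed

lemma has_sum_norm_hs:
  assumes "is_onb B"
  shows "((\<lambda>e. (norm (op_of_hs A e))\<^sup>2) has_sum (norm A)\<^sup>2) B"
proof (rule has_sum_hs_change_basis[OF is_onb_some_onb assms])
  show "((\<lambda>e. (norm (op_of_hs A e))\<^sup>2) has_sum (norm A)\<^sup>2) some_onb"
    unfolding norm_hs_power2_infsum
    using op_of_hs[of A] by (intro has_sum_infsum hilbert_schmidt_summable) simp
qed

text \<open>Polarisation carries the basis independence over from the norm.\<close>

lemma has_sum_inner_hs:
  assumes "is_onb B"
  shows "((\<lambda>e. op_of_hs A e \<bullet> op_of_hs K e) has_sum (A \<bullet> K)) B"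
proof -
  have "((\<lambda>e. (norm (op_of_hs A e))\<^sup>2 + (norm (op_of_hs K e))\<^sup>2 - (norm (op_of_hs (A - K) e))\<^sup>2)
      has_sum (norm A)\<^sup>2 + (norm K)\<^sup>2 - (norm (A - K))\<^sup>2) B"
    using has_sum_add[OF has_sum_add[OF has_sum_norm_hs[OF assms, of A] has_sum_norm_hs[OF assms, of K]]
        has_sum_uminusI[OF has_sum_norm_hs[OF assms, of "A - K"]]] by simp
  from has_sum_divide_const[OF this, of 2] show ?thesis
    by (simp add: dot_norm_neg minus_hs.rep_eq blinfun.diff_left)
qed

section \<open>Compactness of Hilbert-Schmidt operators\<close>

lemma compact_bounded_combinations:
  fixes g :: "'i \<Rightarrow> 'a::real_normed_vector"
  assumes "finite F"
  obtains K where "compact K" "\<And>u. (\<And>i. i \<in> F \<Longrightarrow> \<bar>u i\<bar> \<le> 1) \<Longrightarrow> (\<Sum>i\<in>F. u i *\<^sub>R g i) \<in> K"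
  using assms
proof (induction F arbitrary: thesis rule: finite_induct)
  case empty
  show ?case by (rule empty[of "{0}"]) auto
next
  case (insert j F)
  obtain K where K: "compact K" "\<And>u. (\<And>i. i \<in> F \<Longrightarrow> \<bar>u i\<bar> \<le> 1) \<Longrightarrow> (\<Sum>i\<in>F. u i *\<^sub>R g i) \<in> K"
    using insert.IH by blast
  let ?K = "{x + y | x y. x \<in> (\<lambda>c. c *\<^sub>R g j) ` {-1..1} \<and> y \<in> K}"
  show ?case
  proof (rule insert.prems)
    show "compact ?K"
      by (intro compact_sums K compact_continuous_image continuous_intros) auto
    fix u :: "'i \<Rightarrow> real" assume "\<And>i. i \<in> insert j F \<Longrightarrow> \<bar>u i\<bar> \<le> 1"
    then have "u j *\<^sub>R g j \<in> (\<lambda>c. c *\<^sub>R g j) ` {-1..1}" "(\<Sum>i\<in>F. u i *\<^sub>R g i) \<in> K"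
      using K(2)[of u] by (auto simp: abs_le_iff)
    moreover have "(\<Sum>i\<in>insert j F. u i *\<^sub>R g i) = u j *\<^sub>R g j + (\<Sum>i\<in>F. u i *\<^sub>R g i)"
      using insert.hyps by simp
    ultimately show "(\<Sum>i\<in>insert j F. u i *\<^sub>R g i) \<in> ?K"
      by blast
  qed
qed

lemma compact_closure_if_totally_bounded:
  fixes S :: "'a::complete_space set"
  assumes "\<And>r. r > 0 \<Longrightarrow> \<exists>K. finite K \<and> S \<subseteq> (\<Union>x\<in>K. ball x r)"
  shows "compact (closure S)"
  unfolding compact_eq_totally_bounded complete_eq_closed
proof (intro conjI allI impI)
  show "closed (closure S)" by simp
  fix r :: real assume "r > 0"
  then obtain K where K: "finite K" "S \<subseteq> (\<Union>x\<in>K. ball x (r/2))" using assms[of "r/2"] by auto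
  have "closure S \<subseteq> (\<Union>x\<in>K. cball x (r/2))"
  proof (rule closure_minimal)
    show "S \<subseteq> (\<Union>x\<in>K. cball x (r/2))" using K(2) by (rule order_trans) (intro UN_mono ball_subset_cball order_refl)
  qed (use K(1) in auto)
  also have "\<dots> \<subseteq> (\<Union>x\<in>K. ball x r)" using \<open>r > 0\<close> by fastforce
  finally show "\<exists>K. finite K \<and> closure S \<subseteq> (\<Union>x\<in>K. ball x r)" using K(1) by blast
qed

text \<open>The finite-rank \<open>R\<close> agrees with \<open>A\<close> on the basis vectors in
  \<open>F\<close> and vanishes on the others; the tail of the square sum bounds the operator norm
  of \<open>A - R\<close>. Since \<open>R\<close> maps the unit ball into a compact set, a finite
  net for that set serves for \<open>A\<close> as well.\<close>

lemma hilbert_schmidt_compact: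
  fixes A :: "'a::separable_hilbert_space \<Rightarrow>\<^sub>L 'a"
  assumes "hilbert_schmidt A"
  shows "compact_operator A"
  unfolding compact_operator_def
proof (rule compact_closure_if_totally_bounded)
  fix r :: real assume "r > 0"
  let ?B = "some_onb :: 'a set" and ?q = "\<lambda>e. (norm (A e))\<^sup>2"
  have q: "?q summable_on ?B" by (rule hilbert_schmidt_summable[OF assms])
  obtain F where F: "finite F" "F \<subseteq> ?B" "infsum ?q ?B - (r/2)\<^sup>2 < sum ?q F"
  proof (rule ccontr)
    assume "\<not> thesis"
    then have "infsum ?q ?B \<le> infsum ?q ?B - (r/2)\<^sup>2"
      using that by (intro infsum_le_finite_sums[OF q]) (auto simp: not_less[symmetric])
    then show False using \<open>r > 0\<close> by simp
  qed
  define R where "R = (\<Sum>f\<in>F. blinfun_scaleR_left (A f) o\<^sub>L blinfun_inner_left f)"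
  have R: "R e = (if e \<in> F then A e else 0)" if "e \<in> ?B" for e
    unfolding R_def using F that by (intro finite_rank_apply) auto
  have R': "R x = (\<Sum>f\<in>F. (f \<bullet> x) *\<^sub>R A f)" for x
    by (simp add: R_def blinfun.sum_left inner_commute)
  have "norm (A - R) \<le> r/2"
  proof (rule norm_apply_onb_bound)
    fix G assume G: "finite G" "G \<subseteq> ?B"
    have "(\<Sum>e\<in>G. (norm ((A - R) e))\<^sup>2) = sum ?q (G - F)"
      by (rule sum.mono_neutral_cong_right) (use G R in \<open>auto simp: blinfun.diff_left\<close>)
    also have "\<dots> + sum ?q F = sum ?q (G \<union> F)"
      using G F by (subst sum.union_disjoint[symmetric]) auto
    also have "\<dots> \<le> infsum ?q ?B"
      using G F by (intro finite_sum_le_infsum[OF q]) auto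
    finally show "(\<Sum>e\<in>G. (norm ((A - R) e))\<^sup>2) \<le> (r/2)\<^sup>2" using F(3) by simp
  qed (use \<open>r > 0\<close> in simp)
  then have close: "dist (A x) (R x) \<le> r/2" if "norm x \<le> 1" for x
    using norm_blinfun[of "A - R" x] mult_mono[of "norm (A - R)" "r/2" "norm x" 1] that \<open>r > 0\<close>
    by (simp add: dist_norm blinfun.diff_left)
  obtain K where K: "compact K" "\<And>u. (\<And>f. f \<in> F \<Longrightarrow> \<bar>u f\<bar> \<le> 1) \<Longrightarrow> (\<Sum>f\<in>F. u f *\<^sub>R A f) \<in> K"
    using compact_bounded_combinations[OF F(1), of "blinfun_apply A"] by blast
  obtain k where k: "finite k" "K \<subseteq> (\<Union>x\<in>k. ball x (r/2))"
    using K(1) \<open>r > 0\<close> unfolding compact_eq_totally_bounded by (meson half_gt_zero)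
  have "A x \<in> (\<Union>x\<in>k. ball x r)" if "norm x \<le> 1" for x
  proof -
    have "R x \<in> K" unfolding R'
    proof (rule K(2))
      fix f assume "f \<in> F"
      then show "\<bar>f \<bullet> x\<bar> \<le> 1"
        using Cauchy_Schwarz_ineq2[of f x] some_onb_norm[of f] F(2) that by auto
    qed
    then obtain y where "y \<in> k" "dist y (R x) < r/2" using k(2) by auto
    then show ?thesis using close[OF that] dist_triangle[of y "A x" "R x"]
      by (auto simp: dist_commute intro!: bexI[of _ y])
  qed
  then show "\<exists>K. finite K \<and> blinfun_apply A ` cball 0 1 \<subseteq> (\<Union>x\<in>K. ball x r)"
    using k(1) by (intro exI[of _ k]) auto
qed

section \<open>The spectral theorem for compact self-adjoint operators\<close>

text \<open>A maximising sequence for |T x| on the unit sphere of \<open>W\<close> is asymptotically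
  an eigenvector of the square of \<open>T\<close> for m^2, and compactness makes a subsequence
  converge. Maximising |T x| instead of the quadratic form leaves the sign of the eigenvalue open;
  it is settled at the end.\<close>

lemma eigenvector_in_invariant_subspace:
  fixes T :: "'a::real_inner \<Rightarrow>\<^sub>L 'a"
  assumes adj: "\<And>x y. T x \<bullet> y = x \<bullet> T y" and T: "compact_operator T"
    and W: "subspace W" "closed W" "\<And>x. x \<in> W \<Longrightarrow> T x \<in> W" and x0: "x0 \<in> W" "x0 \<noteq> 0"
  obtains u t where "u \<in> W" "norm u = 1" "T u = t *\<^sub>R u"
proof -
  let ?U = "{x \<in> W. norm x = 1}"
  define m where "m = (SUP x\<in>?U. norm (T x))"
  have bdd: "bdd_above ((\<lambda>x. norm (T x)) ` ?U)"
    using norm_blinfun[of T] by (intro bdd_aboveI[of _ "norm T"]) (auto, metis mult.right_neutral)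
  have normalize: "x /\<^sub>R norm x \<in> ?U" if "x \<in> W" "x \<noteq> 0" for x
    using that by (simp add: subspace_scale[OF W(1)])
  have ne: "?U \<noteq> {}" using normalize[OF x0] by blast
  have m_upper: "norm (T x) \<le> m * norm x" if "x \<in> W" for x
  proof (cases "x = 0")
    case False
    have "norm (T (x /\<^sub>R norm x)) \<le> m"
      unfolding m_def by (rule cSUP_upper[OF normalize[OF that False] bdd])
    then show ?thesis using False by (simp add: blinfun.scaleR_right field_simps)
  qed simp
  obtain u0 where u0: "u0 \<in> ?U" using ne by blast
  have "m \<ge> 0" using m_upper[of u0] u0 order_trans[OF norm_ge_zero[of "T u0"]] by simp
  show thesis
  proof (cases "m = 0")
    case True
    then show thesis using m_upper[of u0] u0 by (intro that[of u0 0]) auto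
  next
    case False
    then have m: "m > 0" using \<open>m \<ge> 0\<close> by simp
    have "\<exists>x\<in>?U. norm (T x) > m - inverse (real (Suc n))" for n
    proof -
      have "m - inverse (real (Suc n)) < m" by simp
      then show ?thesis unfolding m_def using less_cSUP_iff[OF ne bdd] by blast
    qed
    then obtain x where x: "\<And>n. x n \<in> ?U" "\<And>n. norm (T (x n)) > m - inverse (real (Suc n))"
      by metis
    have lim_m: "(\<lambda>n. norm (T (x n))) \<longlonglongrightarrow> m"
    proof (rule tendsto_sandwich)
      show "(\<lambda>n. m - inverse (real (Suc n))) \<longlonglongrightarrow> m"
        using tendsto_diff[OF tendsto_const LIMSEQ_inverse_real_of_nat, of m] by simp
      show "\<forall>\<^sub>F n in sequentially. m - inverse (real (Suc n)) \<le> norm (T (x n))"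
        using x(2) by (intro always_eventually allI less_imp_le)
      have "norm (T (x n)) \<le> m" for n using m_upper[of "x n"] x(1)[of n] by simp
      then show "\<forall>\<^sub>F n in sequentially. norm (T (x n)) \<le> m" by simp
    qed (rule tendsto_const)
    have "T (x n) \<in> closure (blinfun_apply T ` cball 0 1)" for n
      using x(1)[of n] closure_subset by fastforce
    then obtain y r where r: "strict_mono r" and y: "(\<lambda>n. T (x (r n))) \<longlonglongrightarrow> y"
      using T unfolding compact_operator_def compact_eq_seq_compact_metric
      by (elim seq_compactE[where f="\<lambda>n. T (x n)"]) (auto simp: comp_def)
    have diff: "(\<lambda>n. T (T (x n)) - m\<^sup>2 *\<^sub>R x n) \<longlonglongrightarrow> 0"
    proof -
      \<comment> \<open>Expand the square: self-adjointness gives <TTx, x> = |Tx|^2, and invariance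
        of \<open>W\<close> gives |TTx| \<le> m |Tx|.\<close>
      have le: "(norm (T (T (x n)) - m\<^sup>2 *\<^sub>R x n))\<^sup>2 \<le> m\<^sup>2 * (m\<^sup>2 - (norm (T (x n)))\<^sup>2)" for n
      proof -
        have "(norm (T (T (x n)) - m\<^sup>2 *\<^sub>R x n))\<^sup>2
            = (norm (T (T (x n))))\<^sup>2 - 2 * m\<^sup>2 * (T (T (x n)) \<bullet> x n) + (m\<^sup>2)\<^sup>2 * (norm (x n))\<^sup>2"
          unfolding power2_norm_eq_inner
          by (simp add: inner_diff_left inner_diff_right inner_commute power2_eq_square)
        also have "T (T (x n)) \<bullet> x n = (norm (T (x n)))\<^sup>2"
          by (simp add: adj power2_norm_eq_inner)
        also have "(norm (T (T (x n))))\<^sup>2 \<le> (m * norm (T (x n)))\<^sup>2"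
          using m_upper[OF W(3)] x(1)[of n] by (intro power_mono) auto
        finally show ?thesis using x(1)[of n]
          by (simp add: power_mult_distrib algebra_simps power2_eq_square)
      qed
      have lim_0: "(\<lambda>n. m\<^sup>2 * (m\<^sup>2 - (norm (T (x n)))\<^sup>2)) \<longlonglongrightarrow> m\<^sup>2 * (m\<^sup>2 - m\<^sup>2)"
        by (intro tendsto_intros lim_m)
      have "(\<lambda>n. (norm (T (T (x n)) - m\<^sup>2 *\<^sub>R x n))\<^sup>2) \<longlonglongrightarrow> 0"
        by (rule Lim_null_comparison[OF _ lim_0[simplified]]) (use le in auto)
      then have "(\<lambda>n. sqrt ((norm (T (T (x n)) - m\<^sup>2 *\<^sub>R x n))\<^sup>2)) \<longlonglongrightarrow> sqrt 0"
        by (rule tendsto_real_sqrt)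
      then show ?thesis by (simp add: tendsto_norm_zero_iff)
    qed
    \<comment> \<open>This is the only possible limit, since \<open>x (r n)\<close> differs from
      \<open>T (T (x (r n))) /\<^sub>R m\<^sup>2\<close> by a null sequence.\<close>
    define u where "u = T y /\<^sub>R m\<^sup>2"
    have xu: "(\<lambda>n. x (r n)) \<longlonglongrightarrow> u"
    proof -
      have "(\<lambda>n. (T (T (x (r n))) - (T (T (x (r n))) - m\<^sup>2 *\<^sub>R x (r n))) /\<^sub>R m\<^sup>2)
          \<longlonglongrightarrow> (T y - 0) /\<^sub>R m\<^sup>2"
        using LIMSEQ_subseq_LIMSEQ[OF diff r] unfolding comp_def
        by (intro tendsto_intros y)
      then show ?thesis using m by (simp add: u_def)
    qed
    have uW: "u \<in> W"
      by (rule closed_sequentially[OF W(2) _ xu]) (use x(1) in blast)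
    have "(\<lambda>n. norm (x (r n))) \<longlonglongrightarrow> norm u" by (intro tendsto_intros xu)
    then have nu: "norm u = 1" using x(1) by (simp add: LIMSEQ_const_iff)
    have "(\<lambda>n. T (x (r n))) \<longlonglongrightarrow> T u" by (intro tendsto_intros xu)
    then have "T u = y" using y LIMSEQ_unique by blast
    then have TTu: "T (T u) = m\<^sup>2 *\<^sub>R u" using m by (simp add: u_def)
    \<comment> \<open>As (T + m)(T - m) u = 0, either \<open>u\<close> is an eigenvector for m or
      \<open>v\<close> is one for -m.\<close>
    define v where "v = T u - m *\<^sub>R u"
    show thesis
    proof (cases "v = 0")
      case True
      then show thesis using uW nu by (intro that[of u m]) (auto simp: v_def)
    next
      case False
      have "T v = - m *\<^sub>R v"
        by (simp add: v_def blinfun.diff_right blinfun.scaleR_right TTu scaleR_diff_right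
            power2_eq_square)
      moreover have "v \<in> W"
        unfolding v_def by (intro subspace_diff subspace_scale W uW)
      ultimately show thesis
        using normalize[OF _ False]
        by (intro that[of "v /\<^sub>R norm v" "- m"]) (auto simp: blinfun.scaleR_right)
    qed
  qed
qed

text \<open>Zorn's lemma on orthonormal sets of eigenvectors. The orthogonal complement of a maximal
  one is invariant because \<open>T\<close> is self-adjoint; were it nonzero, it would contain a
  further eigenvector. Vectors of the kernel count as eigenvectors, so the basis spans the whole
  space.\<close>

theorem spectral_theorem_compact:
  fixes T :: "'a::{real_inner, banach} \<Rightarrow>\<^sub>L 'a"
  assumes adj: "\<And>x y. T x \<bullet> y = x \<bullet> T y" and T: "compact_operator T"
  obtains B s where "is_onb B" "\<And>e. e \<in> B \<Longrightarrow> T e = s e *\<^sub>R e"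
proof -
  let ?A = "{E. orthonormal E \<and> (\<forall>e\<in>E. \<exists>t. T e = t *\<^sub>R e)}"
  have "\<exists>M\<in>?A. \<forall>X\<in>?A. M \<subseteq> X \<longrightarrow> X = M"
  proof (rule subset_Zorn_nonempty)
    have "{} \<in> ?A" by (simp add: orthonormal_def)
    then show "?A \<noteq> {}" by blast
    fix \<C> assume \<C>: "\<C> \<noteq> {}" "subset.chain ?A \<C>"
    have total: "E \<subseteq> E' \<or> E' \<subseteq> E" if "E \<in> \<C>" "E' \<in> \<C>" for E E'
      using \<C>(2) that unfolding subset_chain_def by blast
    have sub: "\<C> \<subseteq> ?A" using \<C>(2) by (simp add: subset_chain_def)
    have "orthonormal (\<Union>\<C>)"
      unfolding orthonormal_def
    proof (intro ballI)
      fix e f assume "e \<in> \<Union>\<C>" "f \<in> \<Union>\<C>"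
      then obtain E E' where "E \<in> \<C>" "e \<in> E" "E' \<in> \<C>" "f \<in> E'" by blast
      then obtain E where "E \<in> \<C>" "e \<in> E" "f \<in> E"
        using total[of E E'] by blast
      moreover then have "orthonormal E" using sub by auto
      ultimately show "e \<bullet> f = (if e = f then 1 else 0)" by (auto simp: orthonormal_def)
    qed
    then show "\<Union>\<C> \<in> ?A" using sub by auto
  qed
  then obtain M where "M \<in> ?A" and max: "\<forall>X\<in>?A. M \<subseteq> X \<longrightarrow> X = M" by (rule bexE)
  then have M: "orthonormal M" "\<And>e. e \<in> M \<Longrightarrow> \<exists>t. T e = t *\<^sub>R e" by simp_all
  let ?W = "{x. \<forall>e\<in>M. x \<bullet> e = 0}"
  have "x = 0" if x: "\<And>e. e \<in> M \<Longrightarrow> x \<bullet> e = 0" for x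
  proof (rule ccontr)
    assume "x \<noteq> 0"
    have W: "subspace ?W" by (auto simp: subspace_def inner_add_left)
    have W_eq: "?W = (\<Inter>e\<in>M. {x. x \<bullet> e = 0})" by auto
    have W': "closed ?W" unfolding W_eq
      by (intro closed_INT ballI closed_Collect_eq continuous_intros)
    have W'': "T y \<in> ?W" if "y \<in> ?W" for y
      using that M(2) by (fastforce simp: adj)
    obtain u t where u: "u \<in> ?W" "norm u = 1" "T u = t *\<^sub>R u"
      by (rule eigenvector_in_invariant_subspace[OF adj T W W' W'' _ \<open>x \<noteq> 0\<close>]) (use x in auto)
    have "insert u M \<in> ?A"
      using u M by (auto simp: orthonormal_def norm_eq_1 inner_commute)
    then have "insert u M = M" by (rule max[THEN bspec, THEN mp]) auto
    then have "u \<in> M" by blast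
    then have "u \<bullet> u = 0" using u(1) by blast
    with u(2) show False by (simp add: norm_eq_1)
  qed
  then have "is_onb M" by (rule is_onbI_total[OF M(1)])
  moreover obtain s where "\<And>e. e \<in> M \<Longrightarrow> T e = s e *\<^sub>R e" using M(2) by metis
  ultimately show thesis by (rule that)
qed

section \<open>Square roots\<close>

lemma nonneg_definite_adjoint: "nonneg_definite A \<Longrightarrow> A x \<bullet> y = x \<bullet> A y"
  unfolding nonneg_definite_def by blast

lemma nonneg_definite_inner: "nonneg_definite A \<Longrightarrow> 0 \<le> A x \<bullet> x"
  unfolding nonneg_definite_def by blast

lemma diagonal_inner:
  fixes S :: "'a::{real_inner, banach} \<Rightarrow>\<^sub>L 'a"
  assumes "is_onb B" "\<And>e. e \<in> B \<Longrightarrow> S e = s e *\<^sub>R e"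
  shows "((\<lambda>e. s e * (x \<bullet> e) * (y \<bullet> e)) has_sum (S x \<bullet> y)) B"
proof -
  have "((\<lambda>e. ((x \<bullet> e) *\<^sub>R S e) \<bullet> y) has_sum (S x \<bullet> y)) B"
    by (rule has_sum_bounded_linear[OF bounded_linear_inner_left[of y]
          onb_expansion_blinfun[OF assms(1), of x S]])
  then show ?thesis
    by (rule has_sum_cong[THEN iffD1, rotated]) (simp add: assms(2) inner_commute)
qed

lemma diagonal_selfadjoint:
  fixes S :: "'a::{real_inner, banach} \<Rightarrow>\<^sub>L 'a"
  assumes "is_onb B" "\<And>e. e \<in> B \<Longrightarrow> S e = s e *\<^sub>R e"
  shows "S x \<bullet> y = x \<bullet> S y"
  using diagonal_inner[OF assms, of x y] diagonal_inner[OF assms, of y x]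
  by (intro has_sum_unique[where A=B]) (simp_all add: inner_commute mult_ac)

lemma diagonal_nonneg_definite:
  fixes S :: "'a::{real_inner, banach} \<Rightarrow>\<^sub>L 'a"
  assumes "is_onb B" "\<And>e. e \<in> B \<Longrightarrow> S e = s e *\<^sub>R e" "\<And>e. e \<in> B \<Longrightarrow> s e \<ge> 0"
  shows "nonneg_definite S"
  unfolding nonneg_definite_def
  using diagonal_selfadjoint[OF assms(1,2)]
    has_sum_nonneg[OF diagonal_inner[OF assms(1,2)]] assms(3) by (auto simp: mult.assoc)

text \<open>Local form of the uniqueness of square roots. For t > 0 the vector y = S e - sqrt(t) e
  satisfies S y = - sqrt(t) y, which non-negativity allows only for y = 0; for t = 0 one has |S e|^2
  = <S S e, e> = 0.\<close>

lemma nonneg_square_root_eigenvector: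
  fixes S :: "'a::real_inner \<Rightarrow>\<^sub>L 'a"
  assumes S: "nonneg_definite S" and e: "S (S e) = t *\<^sub>R e" and t: "t \<ge> 0"
  shows "S e = sqrt t *\<^sub>R e"
proof (cases "t = 0")
  case True
  have "S e \<bullet> S e = S (S e) \<bullet> e" by (rule nonneg_definite_adjoint[OF S, symmetric])
  then show ?thesis using True e by simp
next
  case False
  let ?y = "S e - sqrt t *\<^sub>R e"
  have "S ?y = - sqrt t *\<^sub>R ?y"
    using t by (simp add: blinfun.diff_right blinfun.scaleR_right e scaleR_diff_right)
  moreover have "0 \<le> S ?y \<bullet> ?y" by (rule nonneg_definite_inner[OF S])
  ultimately have "sqrt t * (?y \<bullet> ?y) \<le> 0" by simp
  then have "?y \<bullet> ?y \<le> 0" using False t by (simp add: mult_le_0_iff)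
  then have "?y \<bullet> ?y = 0" by (rule order_antisym) (rule inner_ge_zero)
  then show ?thesis by (simp only: inner_eq_zero_iff right_minus_eq)
qed

text \<open>Discharges the definite description in \<open>op_sqrt\<close>. The root with eigenvalues
  \<open>sqrt (s e)\<close> is bounded because each \<open>s e\<close> is at most
  \<open>norm A\<close>, and any other root is forced to the same values on the
  eigenvectors.\<close>

lemma op_sqrt_diagonal:
  fixes A :: "'a::{real_inner, banach} \<Rightarrow>\<^sub>L 'a"
  assumes B: "is_onb B" and A: "\<And>e. e \<in> B \<Longrightarrow> A e = s e *\<^sub>R e" and s: "\<And>e. e \<in> B \<Longrightarrow> s e \<ge> 0"
  shows "nonneg_definite (op_sqrt A)" "op_sqrt A o\<^sub>L op_sqrt A = A"
    "\<And>e. e \<in> B \<Longrightarrow> op_sqrt A e = sqrt (s e) *\<^sub>R e"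
proof -
  obtain S :: "'a \<Rightarrow>\<^sub>L 'a" where S: "\<And>e. e \<in> B \<Longrightarrow> S e = sqrt (s e) *\<^sub>R e"
  proof (rule orthogonal_extension[OF B, of "\<lambda>e. sqrt (s e) *\<^sub>R e" "sqrt (norm A)"])
    fix e assume e: "e \<in> B"
    have "s e = norm (A e)" using A[OF e] s[OF e] is_onb_norm[OF B e] by simp
    also have "\<dots> \<le> norm A" using norm_blinfun[of A e] is_onb_norm[OF B e] by simp
    finally show "norm (sqrt (s e) *\<^sub>R e) \<le> sqrt (norm A)"
      using s[OF e] is_onb_norm[OF B e] by simp
  qed (use is_onb_orthonormal[OF B] in \<open>auto simp: orthonormal_def\<close>)
  have "nonneg_definite S" by (rule diagonal_nonneg_definite[OF B S]) (use s in auto)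
  moreover have "S o\<^sub>L S = A"
    by (rule blinfun_eq_on_onb[OF B]) (use s in \<open>simp add: S A blinfun.scaleR_right\<close>)
  moreover have "S' = S" if S': "nonneg_definite S' \<and> S' o\<^sub>L S' = A" for S'
  proof (rule blinfun_eq_on_onb[OF B])
    fix e assume e: "e \<in> B"
    have "S' (S' e) = s e *\<^sub>R e" using S' A[OF e] by (metis blinfun_apply_blinfun_compose)
    then show "S' e = S e"
      unfolding S[OF e] using S' by (intro nonneg_square_root_eigenvector s e) auto
  qed
  ultimately have "op_sqrt A = S" unfolding op_sqrt_def by (intro the_equality conjI)
  with \<open>nonneg_definite S\<close> \<open>S o\<^sub>L S = A\<close> S
  show "nonneg_definite (op_sqrt A)" "op_sqrt A o\<^sub>L op_sqrt A = A"
    "\<And>e. e \<in> B \<Longrightarrow> op_sqrt A e = sqrt (s e) *\<^sub>R e"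
    by auto
qed

lemma nonneg_compact_diagonal:
  fixes A :: "'a::{real_inner, banach} \<Rightarrow>\<^sub>L 'a"
  assumes "nonneg_definite A" "compact_operator A"
  obtains B s where "is_onb B" "\<And>e. e \<in> B \<Longrightarrow> A e = s e *\<^sub>R e" "\<And>e. e \<in> B \<Longrightarrow> s e \<ge> 0"
proof -
  obtain B s where B: "is_onb B" "\<And>e. e \<in> B \<Longrightarrow> A e = s e *\<^sub>R e"
    using spectral_theorem_compact[OF nonneg_definite_adjoint[OF assms(1)] assms(2)] by blast
  have "s e \<ge> 0" if "e \<in> B" for e
  proof -
    have "0 \<le> A e \<bullet> e" by (rule nonneg_definite_inner[OF assms(1)])
    then show ?thesis
      using B(2)[OF that] is_onb_norm[OF B(1) that] by (simp add: norm_eq_1)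
  qed
  with B show thesis by (rule that)
qed

lemma op_sqrt_compact:
  fixes A :: "'a::{real_inner, banach} \<Rightarrow>\<^sub>L 'a"
  assumes "nonneg_definite A" "compact_operator A"
  shows "nonneg_definite (op_sqrt A)" "op_sqrt A o\<^sub>L op_sqrt A = A"
  using nonneg_compact_diagonal[OF assms] op_sqrt_diagonal[of _ A] by metis+

lemma op_sqrt_square:
  fixes A :: "'a::{real_inner, banach} \<Rightarrow>\<^sub>L 'a"
  assumes "nonneg_definite A" "compact_operator A"
  shows "op_sqrt (A o\<^sub>L A) = A"
proof -
  obtain B s where B: "is_onb B" "\<And>e. e \<in> B \<Longrightarrow> A e = s e *\<^sub>R e" "\<And>e. e \<in> B \<Longrightarrow> s e \<ge> 0"
    using nonneg_compact_diagonal[OF assms] by blast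
  show ?thesis
  proof (rule blinfun_eq_on_onb[OF B(1)])
    fix e assume e: "e \<in> B"
    have "op_sqrt (A o\<^sub>L A) e = sqrt ((s e)\<^sup>2) *\<^sub>R e"
      by (rule op_sqrt_diagonal(3)[OF B(1) _ _ e])
        (simp_all add: B(2) blinfun.scaleR_right power2_eq_square)
    then show "op_sqrt (A o\<^sub>L A) e = A e" using B e by simp
  qed
qed

section \<open>The trace norm\<close>

lemma hilbert_schmidt_iff_onb:
  fixes A :: "'a::separable_hilbert_space \<Rightarrow>\<^sub>L 'a"
  assumes "is_onb B"
  shows "hilbert_schmidt A \<longleftrightarrow> (\<lambda>e. (norm (A e))\<^sup>2) summable_on B"
  using infsum_ennreal_eq_top_iff[of B "\<lambda>e. (norm (A e))\<^sup>2"]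
  by (simp add: hilbert_schmidt_def hs_norm_sq_onb[OF assms] flip: top.not_eq_extremum)

text \<open>The basis diagonalises \<open>op_adjoint A o\<^sub>L A\<close>, so the numbers
  \<open>norm (A e)\<close> are the singular values of \<open>A\<close>: the inner root has
  eigenvalue \<open>norm (A e)\<close> at \<open>e\<close>, the outer one its square root, and the
  Hilbert-Schmidt norm squares it again.\<close>

lemma trace_norm_eigenbasis:
  fixes A :: "'a::separable_hilbert_space \<Rightarrow>\<^sub>L 'a"
  assumes "hilbert_schmidt A"
  obtains B where "is_onb B" "\<And>e f. e \<in> B \<Longrightarrow> f \<in> B \<Longrightarrow> e \<noteq> f \<Longrightarrow> A e \<bullet> A f = 0"
    "trace_norm A = (\<Sum>\<^sub>\<infinity>e\<in>B. ennreal (norm (A e)))"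
proof -
  let ?Q = "op_adjoint A o\<^sub>L A"
  have Q: "?Q x \<bullet> y = A x \<bullet> A y" for x y
    using op_adjoint[of A y "A x"] by (simp add: inner_commute)
  have Q': "x \<bullet> ?Q y = A x \<bullet> A y" for x y
    using Q[of y x] by (simp only: inner_commute)
  have nonneg: "nonneg_definite ?Q"
    unfolding nonneg_definite_def Q Q' by simp
  have "hilbert_schmidt ?Q"
    unfolding hilbert_schmidt_iff_summable
  proof (rule summable_on_comparison_test)
    show "(\<lambda>e. (norm (op_adjoint A))\<^sup>2 * (norm (A e))\<^sup>2) summable_on some_onb"
      by (intro summable_on_cmult_right hilbert_schmidt_summable assms)
    show "(norm (?Q e))\<^sup>2 \<le> (norm (op_adjoint A))\<^sup>2 * (norm (A e))\<^sup>2" for e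
      using power_mono[OF norm_blinfun[of "op_adjoint A" "A e"], of 2]
      by (simp add: power_mult_distrib)
  qed simp
  then obtain B s where B: "is_onb B" and s: "\<And>e. e \<in> B \<Longrightarrow> ?Q e = s e *\<^sub>R e"
    "\<And>e. e \<in> B \<Longrightarrow> s e \<ge> 0"
    using nonneg_compact_diagonal[OF nonneg hilbert_schmidt_compact] by blast
  have inner: "A e \<bullet> A f = s e * (e \<bullet> f)" if "e \<in> B" for e f
    using Q[of e f] s(1)[OF that] by simp
  have s_eq: "s e = (norm (A e))\<^sup>2" if "e \<in> B" for e
    using inner[OF that, of e] is_onb_norm[OF B that] by (simp add: power2_norm_eq_inner norm_eq_1)
  have "op_sqrt ?Q e = norm (A e) *\<^sub>R e" if "e \<in> B" for e
    using op_sqrt_diagonal(3)[OF B s that] by (simp add: s_eq[OF that])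
  then have S: "op_sqrt (op_sqrt ?Q) e = sqrt (norm (A e)) *\<^sub>R e" if "e \<in> B" for e
    by (rule op_sqrt_diagonal(3)[OF B _ _ that]) auto
  have "trace_norm A = (\<Sum>\<^sub>\<infinity>e\<in>B. ennreal (norm (A e)))"
    unfolding trace_norm_def hs_norm_sq_onb[OF B]
    by (rule infsum_cong) (simp add: S is_onb_norm[OF B])
  moreover have "A e \<bullet> A f = 0" if "e \<in> B" "f \<in> B" "e \<noteq> f" for e f
    using inner[OF that(1)] is_onb_orthonormal[OF B] that by (simp add: orthonormal_def)
  ultimately show thesis using B by (intro that)
qed

text \<open>The dual description of the trace norm as a supremum of continuous linear functionals yields
  its subadditivity, its lower semicontinuity and its compatibility with integrals.\<close>

definition trace_dual :: "'a::separable_hilbert_space hs \<Rightarrow> ennreal" where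
  "trace_dual A = (SUP K\<in>{K. norm (op_of_hs K) \<le> 1}. ennreal (A \<bullet> K))"

lemma trace_dual_upper: "norm (op_of_hs K) \<le> 1 \<Longrightarrow> ennreal (A \<bullet> K) \<le> trace_dual A"
  unfolding trace_dual_def by (rule SUP_upper) simp

text \<open>The test operator sends each \<open>e\<close> in \<open>F\<close> to \<open>g e\<close>
  and the other basis vectors to 0. It is used with \<open>sgn (A e)\<close> for the duality and
  with the signs of the eigenvalues for the Powers-Stormer inequality.\<close>

lemma sum_inner_le_trace_dual:
  fixes A :: "'a::separable_hilbert_space hs"
  assumes B: "is_onb B" and F: "finite F" "F \<subseteq> B"
    and g: "\<And>e f. e \<in> F \<Longrightarrow> f \<in> F \<Longrightarrow> e \<noteq> f \<Longrightarrow> g e \<bullet> g f = 0" "\<And>e. e \<in> F \<Longrightarrow> norm (g e) \<le> 1"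
  shows "ennreal (\<Sum>e\<in>F. op_of_hs A e \<bullet> g e) \<le> trace_dual A"
proof -
  obtain K :: "'a \<Rightarrow>\<^sub>L 'a" where K: "\<And>e. e \<in> B \<Longrightarrow> K e = (if e \<in> F then g e else 0)" "norm K \<le> 1"
    by (rule orthogonal_extension[OF B, of "\<lambda>e. if e \<in> F then g e else 0" 1]) (use g in auto)
  have "hilbert_schmidt K"
    unfolding hilbert_schmidt_iff_onb[OF B]
    by (rule finite_nonzero_values_imp_summable_on, rule finite_subset[OF _ F(1)])
      (use K in \<open>auto split: if_splits\<close>)
  then have K': "op_of_hs (Abs_hs K) = K" by (simp add: Abs_hs_inverse)
  have "((\<lambda>e. op_of_hs A e \<bullet> K e) has_sum (\<Sum>e\<in>F. op_of_hs A e \<bullet> g e)) B"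
    by (rule has_sum_finite_neutralI[OF F]) (use F K in \<open>auto intro!: sum.cong\<close>)
  then have "A \<bullet> Abs_hs K = (\<Sum>e\<in>F. op_of_hs A e \<bullet> g e)"
    using has_sum_inner_hs[OF B, of A "Abs_hs K"] by (simp add: K' has_sum_unique)
  then show ?thesis
    using trace_dual_upper[of "Abs_hs K" A] K(2) by (simp add: K')
qed

text \<open>For one direction, \<open>e\<close> is sent to \<open>sgn (A e)\<close>, the partial
  isometry of the polar decomposition cut down to finitely many basis vectors. The other is
  Cauchy-Schwarz on each basis vector.\<close>

theorem trace_norm_eq_trace_dual: "trace_norm (op_of_hs A) = trace_dual A"
proof -
  obtain B where B: "is_onb B"
    and orth: "\<And>e f. e \<in> B \<Longrightarrow> f \<in> B \<Longrightarrow> e \<noteq> f \<Longrightarrow> op_of_hs A e \<bullet> op_of_hs A f = 0"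
    and tn: "trace_norm (op_of_hs A) = (\<Sum>\<^sub>\<infinity>e\<in>B. ennreal (norm (op_of_hs A e)))"
    using trace_norm_eigenbasis[of "op_of_hs A"] op_of_hs[of A] by auto
  show ?thesis
  proof (rule antisym)
    have "ennreal (\<Sum>e\<in>F. norm (op_of_hs A e)) \<le> trace_dual A" if F: "finite F" "F \<subseteq> B" for F
    proof -
      have "ennreal (\<Sum>e\<in>F. op_of_hs A e \<bullet> sgn (op_of_hs A e)) \<le> trace_dual A"
      proof (rule sum_inner_le_trace_dual[OF B F])
        fix e f assume "e \<in> F" "f \<in> F" "e \<noteq> f"
        then show "sgn (op_of_hs A e) \<bullet> sgn (op_of_hs A f) = 0"
          using orth F by (auto simp: sgn_div_norm)
      qed (simp add: norm_sgn)
      also have "(\<Sum>e\<in>F. op_of_hs A e \<bullet> sgn (op_of_hs A e)) = (\<Sum>e\<in>F. norm (op_of_hs A e))"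
      proof (intro sum.cong refl)
        show "op_of_hs A e \<bullet> sgn (op_of_hs A e) = norm (op_of_hs A e)" for e
          by (cases "op_of_hs A e = 0") (simp_all add: sgn_div_norm dot_square_norm power2_eq_square)
      qed
      finally show ?thesis .
    qed
    then show "trace_norm (op_of_hs A) \<le> trace_dual A"
      by (simp add: tn infsum_ennreal_SUP SUP_le_iff)
    show "trace_dual A \<le> trace_norm (op_of_hs A)"
      unfolding trace_dual_def
    proof (rule SUP_least)
      fix K :: "'a hs" assume "K \<in> {K. norm (op_of_hs K) \<le> 1}"
      then have K: "norm (op_of_hs K) \<le> 1" by simp
      show "ennreal (A \<bullet> K) \<le> trace_norm (op_of_hs A)"
      proof (cases "(\<lambda>e. norm (op_of_hs A e)) summable_on B")
        case True
        then obtain S where S: "((\<lambda>e. norm (op_of_hs A e)) has_sum S) B"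
          by (auto simp: summable_on_def)
        have "A \<bullet> K \<le> S"
        proof (rule has_sum_mono[OF has_sum_inner_hs[OF B] S])
          fix e assume e: "e \<in> B"
          have "norm (op_of_hs K e) \<le> 1"
            using norm_blinfun[of "op_of_hs K" e] K is_onb_norm[OF B e] by simp
          then show "op_of_hs A e \<bullet> op_of_hs K e \<le> norm (op_of_hs A e)"
            using norm_cauchy_schwarz[of "op_of_hs A e" "op_of_hs K e"]
              mult_left_mono[of "norm (op_of_hs K e)" 1 "norm (op_of_hs A e)"] by simp
        qed
        then show ?thesis
          unfolding tn infsum_ennreal_has_sum[OF norm_ge_zero S] by (rule ennreal_leI)
      next
        case False
        then have "trace_norm (op_of_hs A) = \<infinity>"
          unfolding tn by (subst infsum_ennreal_eq_top_iff) auto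
        then show ?thesis by simp
      qed
    qed
  qed
qed

section \<open>Consequences of the duality\<close>

lemma trace_class_iff: "trace_class (op_of_hs A) \<longleftrightarrow> trace_dual A < \<infinity>"
proof -
  have "compact_operator (op_of_hs A)"
    using op_of_hs[of A] by (intro hilbert_schmidt_compact) simp
  then show ?thesis by (simp add: trace_class_def trace_norm_eq_trace_dual)
qed

lemma trace_dual_leI:
  assumes "\<And>K. norm (op_of_hs K) \<le> 1 \<Longrightarrow> A \<bullet> K \<le> c"
  shows "trace_dual A \<le> ennreal c"
  unfolding trace_dual_def using assms by (auto intro!: SUP_least ennreal_leI)

lemma inner_le_trace_dual:
  assumes "trace_dual A \<le> ennreal c" "c \<ge> 0" "norm (op_of_hs K) \<le> 1"
  shows "A \<bullet> K \<le> c"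
  using order_trans[OF trace_dual_upper[OF assms(3)] assms(1)] assms(2)
  by (simp add: ennreal_le_iff)

lemma trace_dual_0 [simp]: "trace_dual 0 = 0"
  using trace_dual_leI[of 0 0] by simp

lemma trace_dual_add: "trace_dual (A + B) \<le> trace_dual A + trace_dual B"
  unfolding trace_dual_def[of "A + B"]
proof (rule SUP_least)
  fix K :: "'a hs" assume K: "K \<in> {K. norm (op_of_hs K) \<le> 1}"
  \<comment> \<open>\<open>ennreal\<close> truncates negative reals to 0 and is additive only on
    nonnegative ones, hence the positive parts.\<close>
  have "ennreal ((A + B) \<bullet> K) \<le> ennreal (max 0 (A \<bullet> K) + max 0 (B \<bullet> K))"
    by (intro ennreal_leI) (simp add: inner_add_left)
  also have "\<dots> = ennreal (A \<bullet> K) + ennreal (B \<bullet> K)"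
    by (simp add: ennreal_plus max_def ennreal_neg)
  also have "\<dots> \<le> trace_dual A + trace_dual B"
    using K by (intro add_mono trace_dual_upper) auto
  finally show "ennreal ((A + B) \<bullet> K) \<le> trace_dual A + trace_dual B" .
qed

lemma trace_dual_sum: "trace_dual (sum f F) \<le> (\<Sum>i\<in>F. trace_dual (f i))"
proof (induction F rule: infinite_finite_induct)
  case (insert i F)
  then show ?case
    using order_trans[OF trace_dual_add[of "f i" "sum f F"] add_left_mono[OF insert.IH]] by simp
qed auto

text \<open>The superlevel sets are unions of open sets, so the uncountable supremum does no
  harm.\<close>

lemma borel_measurable_trace_dual [measurable]:
  "trace_dual \<in> borel_measurable borel"
proof (rule borel_measurableI_greater)
  fix y :: ennreal
  have eq: "{A. y < trace_dual A} = (\<Union>K\<in>{K. norm (op_of_hs K) \<le> 1}. {A. y < ennreal (A \<bullet> K)})"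
    by (auto simp: trace_dual_def less_SUP_iff)
  have "open {A. y < ennreal (A \<bullet> K)}" for K :: "'a hs"
    by (intro open_Collect_less continuous_intros continuous_on_ennreal)
  then have "open {A :: 'a hs. y < trace_dual A}" unfolding eq by (intro open_UN ballI)
  then show "{A \<in> space borel. y < trace_dual A} \<in> sets (borel :: 'a hs measure)" by simp
qed

lemma trace_dual_limit_le:
  assumes "A \<longlonglongrightarrow> L" "\<And>n. trace_dual (A n) \<le> ennreal c" "c \<ge> 0"
  shows "trace_dual L \<le> ennreal c"
proof (rule trace_dual_leI)
  fix K :: "'a hs" assume K: "norm (op_of_hs K) \<le> 1"
  have "(\<lambda>n. A n \<bullet> K) \<longlonglongrightarrow> L \<bullet> K" by (intro tendsto_intros assms(1))
  then show "L \<bullet> K \<le> c"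
    by (rule LIMSEQ_le_const2) (use inner_le_trace_dual[OF assms(2,3) K] in auto)
qed

text \<open>A real-valued \<open>SUP\<close> dominates its members only if they are bounded above;
  the constant in \<open>bounded_on_trace_class\<close> provides this.\<close>

lemma trace_onorm_nonneg_bound:
  assumes "bounded_on_trace_class C"
  shows "trace_onorm C \<ge> 0"
    and "trace_dual A < \<infinity> \<Longrightarrow> trace_dual (C A) \<le> ennreal (trace_onorm C) * trace_dual A"
proof -
  let ?S = "{A. trace_class (op_of_hs A)}"
  let ?r = "\<lambda>A. enn2real (trace_norm (op_of_hs (C A))) / enn2real (trace_norm (op_of_hs A))"
  obtain K where K: "\<And>A. trace_class (op_of_hs A) \<Longrightarrow>
      trace_dual (C A) \<le> ennreal K * trace_dual A"
    using assms by (auto simp: bounded_on_trace_class_def trace_norm_eq_trace_dual)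
  \<comment> \<open>The constant \<open>K\<close> may be negative, in which case
    \<open>ennreal K\<close> is 0.\<close>
  have ratio: "?r A \<le> max K 0" if A: "A \<in> ?S" for A
  proof -
    obtain a where a: "trace_dual A = ennreal a" "a \<ge> 0"
      using A by (cases "trace_dual A") (auto simp: trace_class_iff)
    have "trace_dual (C A) \<le> ennreal (max K 0 * a)"
      using K[of A] A a by (cases "K \<ge> 0") (auto simp: ennreal_mult max_def ennreal_neg)
    then have "enn2real (trace_dual (C A)) \<le> max K 0 * a"
      using a by (intro enn2real_leI) auto
    then show ?thesis
      using a by (cases "a = 0") (auto simp: trace_norm_eq_trace_dual divide_le_eq)
  qed
  have upper: "?r A \<le> trace_onorm C" if "A \<in> ?S" for A
    unfolding trace_onorm_def using that ratio by (intro cSUP_upper bdd_aboveI) auto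
  \<comment> \<open>At the zero operator the ratio is 0 / 0 = 0.\<close>
  show nonneg: "trace_onorm C \<ge> 0"
    using upper[of 0] by (simp add: trace_class_iff trace_norm_eq_trace_dual)
  assume A: "trace_dual A < \<infinity>"
  then obtain a where a: "trace_dual A = ennreal a" "a \<ge> 0"
    by (cases "trace_dual A") auto
  have tc: "trace_class (op_of_hs A)" using A by (simp add: trace_class_iff)
  show "trace_dual (C A) \<le> ennreal (trace_onorm C) * trace_dual A"
  proof (cases "a = 0")
    \<comment> \<open>Here the ratio is 0 by convention and carries no information; the bound by
      \<open>K\<close> still forces the image to have trace norm 0.\<close>
    case True
    then show ?thesis using K[OF tc] a by simp
  next
    case False
    have "trace_dual (C A) < \<infinity>"
      using assms tc by (auto simp: bounded_on_trace_class_def trace_class_iff)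
    then obtain c where c: "trace_dual (C A) = ennreal c" "c \<ge> 0"
      by (cases "trace_dual (C A)") auto
    have "c / a \<le> trace_onorm C"
      using upper[of A] tc a c by (simp add: trace_norm_eq_trace_dual)
    then have "c \<le> trace_onorm C * a" using False a by (simp add: field_simps)
    then show ?thesis
      using a c nonneg by (simp add: ennreal_leI flip: ennreal_mult)
  qed
qed

section \<open>The Powers--Stormer inequality\<close>

lemma op_adjoint_nonneg_definite:
  fixes A :: "'a::separable_hilbert_space \<Rightarrow>\<^sub>L 'a"
  assumes "nonneg_definite A"
  shows "op_adjoint A = A"
  by (rule blinfun_eqI, rule vector_eq_ldot[THEN iffD1])
    (simp add: nonneg_definite_adjoint[OF assms] flip: op_adjoint)

text \<open>For a non-negative definite \<open>A\<close> the inner root in \<open>trace_norm\<close>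
  returns \<open>A\<close> itself, so the trace norm is
  \<open>hs_norm_sq (op_sqrt A)\<close>.\<close>

lemma hilbert_schmidt_op_sqrt:
  fixes A :: "'a::separable_hilbert_space \<Rightarrow>\<^sub>L 'a"
  assumes "nonneg_definite A" "trace_class A"
  shows "hilbert_schmidt (op_sqrt A)"
  using assms op_sqrt_square[of A]
  by (simp add: trace_class_def trace_norm_def op_adjoint_nonneg_definite hilbert_schmidt_def)

text \<open>Diagonalise \<open>T = \<surd>A - \<surd>B\<close>. For a unit vector \<open>e\<close> with \<open>T e = t e\<close> one has
  \<open>\<langle>(A - B) e, e\<rangle> = t \<langle>(\<surd>A + \<surd>B) e, e\<rangle>\<close>, and \<open>\<langle>(\<surd>A + \<surd>B) e, e\<rangle> \<ge> \<bar>\<langle>T e, e\<rangle>\<bar> = \<bar>t\<bar>\<close>.\<close>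

theorem powers_stormer:
  fixes A B :: "'a::separable_hilbert_space hs"
  assumes A: "nonneg_definite (op_of_hs A)" "trace_class (op_of_hs A)"
    and B: "nonneg_definite (op_of_hs B)" "trace_class (op_of_hs B)"
  shows "hs_norm_sq (op_sqrt (op_of_hs A) - op_sqrt (op_of_hs B)) \<le> trace_dual (A - B)"
proof -
  define a b where "a = op_sqrt (op_of_hs A)" and "b = op_sqrt (op_of_hs B)"
  let ?T = "a - b"
  have ab: "nonneg_definite a" "a o\<^sub>L a = op_of_hs A" "nonneg_definite b" "b o\<^sub>L b = op_of_hs B"
    unfolding a_def b_def using A B by (auto intro!: op_sqrt_compact simp: trace_class_def)
  \<comment> \<open>Finiteness of the two trace norms enters here; it makes the difference of the
    roots compact and thus diagonalisable.\<close>
  have "hilbert_schmidt ?T"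
    unfolding a_def b_def by (intro hilbert_schmidt_diff hilbert_schmidt_op_sqrt A B)
  then have "compact_operator ?T" by (rule hilbert_schmidt_compact)
  moreover have "?T x \<bullet> y = x \<bullet> ?T y" for x y
    by (simp add: blinfun.diff_left inner_diff_left inner_diff_right
        nonneg_definite_adjoint[OF ab(1)] nonneg_definite_adjoint[OF ab(3)])
  ultimately obtain E t where E: "is_onb E" and t: "\<And>e. e \<in> E \<Longrightarrow> ?T e = t e *\<^sub>R e"
    using spectral_theorem_compact by blast
  have key: "(t e)\<^sup>2 \<le> op_of_hs (A - B) e \<bullet> (sgn (t e) *\<^sub>R e)" if e: "e \<in> E" for e
  proof -
    have ae: "a e = b e + t e *\<^sub>R e" using t[OF e] by (simp add: blinfun.diff_left algebra_simps)
    have ee: "e \<bullet> e = 1" using is_onb_norm[OF E e] by (simp add: norm_eq_1)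
    have "op_of_hs (A - B) e \<bullet> e = a e \<bullet> a e - b e \<bullet> b e"
      using nonneg_definite_adjoint[OF ab(1), of "a e" e] nonneg_definite_adjoint[OF ab(3), of "b e" e]
      by (simp add: minus_hs.rep_eq blinfun.diff_left inner_diff_left ab(2)[symmetric] ab(4)[symmetric])
    also have "\<dots> = t e * (a e \<bullet> e + b e \<bullet> e)"
      by (simp add: ae inner_add_left inner_add_right inner_commute[of e "b e"] ee algebra_simps)
    finally have *: "op_of_hs (A - B) e \<bullet> (sgn (t e) *\<^sub>R e) = \<bar>t e\<bar> * (a e \<bullet> e + b e \<bullet> e)"
      by (simp add: abs_sgn mult_ac)
    have "t e = a e \<bullet> e - b e \<bullet> e" by (simp add: ae inner_add_left ee)
    then have "\<bar>t e\<bar> \<le> a e \<bullet> e + b e \<bullet> e"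
      using nonneg_definite_inner[OF ab(1), of e] nonneg_definite_inner[OF ab(3), of e] by linarith
    from mult_left_mono[OF this abs_ge_zero[of "t e"]] show ?thesis
      unfolding * by (simp add: power2_eq_square)
  qed
  have "ennreal (\<Sum>e\<in>F. (norm (?T e))\<^sup>2) \<le> trace_dual (A - B)" if F: "finite F" "F \<subseteq> E" for F
  proof -
    have "(\<Sum>e\<in>F. (norm (?T e))\<^sup>2) = (\<Sum>e\<in>F. (t e)\<^sup>2)"
      by (intro sum.cong refl) (use F t is_onb_norm[OF E] in \<open>auto simp: subset_iff\<close>)
    also have "\<dots> \<le> (\<Sum>e\<in>F. op_of_hs (A - B) e \<bullet> (sgn (t e) *\<^sub>R e))"
      using F by (intro sum_mono key) auto
    \<comment> \<open>The test vectors are the images of the eigenvectors under the sign of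
      \<open>?T\<close>: orthogonal, and of norm 0 or 1.\<close>
    also have "ennreal \<dots> \<le> trace_dual (A - B)"
      by (rule sum_inner_le_trace_dual[OF E F])
        (use F is_onb_norm[OF E] is_onb_orthonormal[OF E] in
          \<open>auto simp: orthonormal_def subset_iff abs_sgn_eq\<close>)
    finally show ?thesis by (simp add: ennreal_leI)
  qed
  then show ?thesis
    unfolding a_def[symmetric] b_def[symmetric] hs_norm_sq_onb[OF E]
    by (simp add: infsum_ennreal_SUP SUP_le_iff)
qed

section \<open>Linear integral equations driven by a step function\<close>

lemma integrable_blinfun_apply:
  fixes f :: "real \<Rightarrow> 'b::banach" and C :: "'b \<Rightarrow>\<^sub>L 'c::real_normed_vector"
  assumes "f integrable_on S"
  shows "(\<lambda>s. C (f s)) integrable_on S"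
  using integrable_linear[OF assms blinfun.bounded_linear_right[of C]] by (simp add: comp_def)

text \<open>The Picard iterates \<open>J + I k\<close> inherit the bound from \<open>J\<close>, and they converge to \<open>D\<close> in
  Hilbert--Schmidt norm, for which the trace norm is lower semicontinuous. In contrast to a direct
  application of Gronwall's inequality, this does not presuppose that the trace norm of \<open>D\<close> is
  locally bounded.\<close>

lemma trace_dual_linear_integral_equation:
  fixes C :: "'h::separable_hilbert_space hs \<Rightarrow>\<^sub>L 'h hs" and D J :: "real \<Rightarrow> 'h hs"
  assumes C: "bounded_on_trace_class C"
    and J: "J integrable_on {0..T}" "\<And>s. s \<in> {0..T} \<Longrightarrow> trace_dual (J s) \<le> ennreal j" "j \<ge> 0"
    and D: "(\<lambda>s. C (D s)) integrable_on {0..T}"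
      "\<And>t. t \<in> {0..T} \<Longrightarrow> D t = integral {0..t} (\<lambda>s. C (D s)) + J t"
    and t: "t \<in> {0..T}"
  shows "trace_dual (D t) \<le> ennreal (exp (trace_onorm C * t) * j)"
proof -
  define c where "c = trace_onorm C"
  have c: "c \<ge> 0" unfolding c_def by (rule trace_onorm_nonneg_bound(1)[OF C])
  \<comment> \<open>Only the integral part is iterated. It is continuous, so integrability of the
    next integrand reduces to that of \<open>J\<close>, which may jump.\<close>
  define I where "I = rec_nat (\<lambda>_. 0) (\<lambda>_ f t. integral {0..t} (\<lambda>s. C (J s + f s)))"
  have I_0: "I 0 = (\<lambda>_. 0)" and I_Suc: "I (Suc k) = (\<lambda>t. integral {0..t} (\<lambda>s. C (J s + I k s)))" for k
    by (simp_all add: I_def)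
  have cont: "continuous_on {0..T} (I k)" and int: "(\<lambda>s. C (J s + I k s)) integrable_on {0..T}" for k
  proof (induction k)
    case 0
    show "continuous_on {0..T} (I 0)" by (simp add: I_0)
    show "(\<lambda>s. C (J s + I 0 s)) integrable_on {0..T}"
      using J(1) by (simp add: I_0 integrable_blinfun_apply)
  next
    case (Suc k)
    show *: "continuous_on {0..T} (I (Suc k))"
      unfolding I_Suc by (rule indefinite_integral_continuous_1[OF Suc.IH(2)])
    show "(\<lambda>s. C (J s + I (Suc k) s)) integrable_on {0..T}"
      by (intro integrable_blinfun_apply integrable_add J integrable_continuous_real *)
  qed
  have sub: "f integrable_on {0..t}" if "f integrable_on {0..T}" "t \<in> {0..T}" for f :: "real \<Rightarrow> 'h hs" and t
    by (rule integrable_subinterval_real[OF that(1)]) (use that in auto)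

  \<comment> \<open>The function exp(c t) j solves the scalar equation f(t) = j + c \<integral> f,
    so the induction reproduces the bound exactly, uniformly in \<open>k\<close>.\<close>
  have bound: "trace_dual (J t + I k t) \<le> ennreal (exp (c * t) * j)" if "t \<in> {0..T}" for k t
    using that
  proof (induction k arbitrary: t)
    case 0
    have "1 * j \<le> exp (c * t) * j" using c J(3) 0 by (intro mult_right_mono) auto
    with J(2)[OF 0] show ?case by (simp add: I_0) (meson ennreal_leI order_trans)
  next
    case (Suc k)
    have t: "0 \<le> t" "t \<le> T" using Suc.prems by auto
    show ?case
    proof (rule trace_dual_leI)
      \<comment> \<open>Pairing with a fixed \<open>K\<close> leaves a real integral whose integrand
        is compared pointwise; the trace norm itself is never integrated in time.\<close>
      fix K :: "'h hs" assume K: "norm (op_of_hs K) \<le> 1"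
      have "((\<lambda>s. C (J s + I k s)) has_integral I (Suc k) t) {0..t}"
        unfolding I_Suc using sub[OF int Suc.prems] by blast
      from has_integral_linear[OF this bounded_linear_inner_left[of K]]
      have 1: "((\<lambda>s. C (J s + I k s) \<bullet> K) has_integral (I (Suc k) t \<bullet> K)) {0..t}"
        by (simp add: comp_def)
      have 2: "((\<lambda>s. c * (exp (c * s) * j)) has_integral (exp (c * t) * j - exp (c * 0) * j)) {0..t}"
        by (rule fundamental_theorem_of_calculus[OF t(1)])
          (auto intro!: derivative_eq_intros simp flip: has_real_derivative_iff_has_vector_derivative)
      have 3: "C (J s + I k s) \<bullet> K \<le> c * (exp (c * s) * j)" if "s \<in> {0..t}" for s
      proof (rule inner_le_trace_dual[OF _ _ K])
        have *: "trace_dual (J s + I k s) \<le> ennreal (exp (c * s) * j)"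
          using that t by (intro Suc.IH) auto
        then have "trace_dual (J s + I k s) < \<infinity>" by (simp add: le_less_trans)
        then have "trace_dual (C (J s + I k s)) \<le> ennreal c * trace_dual (J s + I k s)"
          unfolding c_def by (rule trace_onorm_nonneg_bound(2)[OF C])
        also have "\<dots> \<le> ennreal c * ennreal (exp (c * s) * j)"
          by (intro mult_left_mono *) simp
        also have "\<dots> = ennreal (c * (exp (c * s) * j))"
          using c J(3) by (simp add: ennreal_mult)
        finally show "trace_dual (C (J s + I k s)) \<le> ennreal (c * (exp (c * s) * j))" .
      qed (use c J(3) in simp)
      have "I (Suc k) t \<bullet> K \<le> exp (c * t) * j - j"
        using has_integral_le[OF 1 2 3] by simp
      moreover have "J t \<bullet> K \<le> j" by (rule inner_le_trace_dual[OF J(2)[OF Suc.prems] J(3) K])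
      ultimately show "(J t + I (Suc k) t) \<bullet> K \<le> exp (c * t) * j"
        by (simp add: inner_add_left)
    qed
  qed

  let ?m = "norm C"
  have "continuous_on {0..T} (\<lambda>t. integral {0..t} (\<lambda>s. C (D s)))"
    by (rule indefinite_integral_continuous_1[OF D(1)])
  then have "compact ((\<lambda>t. integral {0..t} (\<lambda>s. C (D s))) ` {0..T})"
    by (rule compact_continuous_image) simp
  then obtain R where R: "\<And>t. t \<in> {0..T} \<Longrightarrow> norm (integral {0..t} (\<lambda>s. C (D s))) \<le> R"
    using compact_imp_bounded bounded_iff by (metis (no_types, lifting) imageI)
  \<comment> \<open>Convergence is needed in Hilbert-Schmidt norm only, so the operator norm
    \<open>?m\<close> on that space governs the error. It starts from \<open>D - J\<close>, a
    continuous integral bounded by \<open>R\<close>.\<close>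
  have err: "norm (D t - (J t + I k t)) \<le> R * (?m * t) ^ k / fact k" if "t \<in> {0..T}" for k t
    using that
  proof (induction k arbitrary: t)
    case 0
    have "D t - (J t + I 0 t) = integral {0..t} (\<lambda>s. C (D s))"
      using D(2)[OF 0] unfolding I_0 by (metis add.right_neutral add_diff_cancel_right')
    with R[OF 0] show ?case by (metis div_by_1 fact_0 mult.right_neutral power_0)
  next
    case (Suc k)
    have t: "0 \<le> t" "t \<le> T" using Suc.prems by auto
    have i: "(\<lambda>s. C (D s) - C (J s + I k s)) integrable_on {0..t}"
      by (intro integrable_diff sub[OF D(1) Suc.prems] sub[OF int Suc.prems])
    have 2: "((\<lambda>s. ?m * (R * (?m * s) ^ k / fact k)) has_integral
        (R * (?m * t) ^ Suc k / fact (Suc k) - R * (?m * 0) ^ Suc k / fact (Suc k))) {0..t}"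
    proof (rule fundamental_theorem_of_calculus[OF t(1)])
      fix s assume "s \<in> {0..t}"
      have "((\<lambda>s. R * (?m * s) ^ Suc k / fact (Suc k)) has_real_derivative
          R * ((1 + real k) * (?m * (?m * s) ^ k)) / fact (Suc k)) (at s within {0..t})"
        by (intro DERIV_cdivide DERIV_cmult DERIV_power_Suc DERIV_cmult_Id)
      moreover have "R * ((1 + real k) * (?m * (?m * s) ^ k)) / fact (Suc k)
          = ?m * (R * (?m * s) ^ k / fact k)"
        by (simp add: divide_simps)
      ultimately show "((\<lambda>s. R * (?m * s) ^ Suc k / fact (Suc k)) has_vector_derivative
          ?m * (R * (?m * s) ^ k / fact k)) (at s within {0..t})"
        by (simp only: has_real_derivative_iff_has_vector_derivative)
    qed
    have "norm (C (D s) - C (J s + I k s)) \<le> ?m * (R * (?m * s) ^ k / fact k)" if "s \<in> {0..t}" for s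
    proof -
      have "norm (C (D s) - C (J s + I k s)) \<le> ?m * norm (D s - (J s + I k s))"
        using norm_blinfun[of C "D s - (J s + I k s)"] by (simp add: blinfun.diff_right)
      also have "\<dots> \<le> ?m * (R * (?m * s) ^ k / fact k)"
        using that t by (intro mult_left_mono Suc.IH) auto
      finally show ?thesis .
    qed
    from integral_norm_bound_integral[OF i _ this] 2
    have "norm (integral {0..t} (\<lambda>s. C (D s) - C (J s + I k s)))
        \<le> R * (?m * t) ^ Suc k / fact (Suc k)"
      by (auto simp: has_integral_iff)
    also have "integral {0..t} (\<lambda>s. C (D s) - C (J s + I k s)) = D t - (J t + I (Suc k) t)"
      unfolding I_Suc D(2)[OF Suc.prems]
      by (subst integral_diff) (auto intro: sub[OF D(1) Suc.prems] sub[OF int Suc.prems])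
    finally show ?case .
  qed
  have "(\<lambda>k. R * (inverse (fact k) * (?m * t) ^ k)) \<longlonglongrightarrow> R * 0"
    by (intro tendsto_intros summable_LIMSEQ_zero summable_exp)
  then have lim0: "(\<lambda>k. R * (?m * t) ^ k / fact k) \<longlonglongrightarrow> 0"
    by (simp add: divide_inverse mult_ac)
  have "(\<lambda>k. D t - (J t + I k t)) \<longlonglongrightarrow> 0"
    by (rule Lim_null_comparison[OF _ lim0]) (use err[OF t] in auto)
  from tendsto_diff[OF tendsto_const this, of "D t"]
  have "(\<lambda>k. J t + I k t) \<longlonglongrightarrow> D t" by (simp add: add.commute)
  then have "trace_dual (D t) \<le> ennreal (exp (c * t) * j)"
    by (rule trace_dual_limit_le) (use bound[OF t] J(3) in auto)
  then show ?thesis by (simp add: c_def)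
qed

text \<open>Each indicator of \<open>i \<le> n s\<close> is nondecreasing in \<open>s\<close>, hence
  integrable, and on the interval only indices up to \<open>n T\<close> contribute.\<close>

lemma step_function_integrable:
  fixes Y :: "nat \<Rightarrow> 'b::banach" and n :: "real \<Rightarrow> nat"
  assumes n: "mono_on {0..} n"
  shows "(\<lambda>s. \<Sum>i = 1..n s. Y i) integrable_on {0..T}"
proof -
  have "(\<lambda>s. of_bool (i \<le> n s) *\<^sub>R Y i) integrable_on {0..T}" for i
  proof -
    have "mono_on {0..T} (\<lambda>s. of_bool (i \<le> n s) :: real)"
      using n by (force simp: mono_on_def)
    then have "(\<lambda>s. of_bool (i \<le> n s) :: real) integrable_on {0..T}"
      by (rule integrable_on_mono_on)
    from integrable_linear[OF this bounded_linear_scaleR_left[of "Y i"]]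
    show ?thesis by (simp add: comp_def)
  qed
  then have "(\<lambda>s. \<Sum>i = 1..n T. of_bool (i \<le> n s) *\<^sub>R Y i) integrable_on {0..T}"
    by (intro integrable_sum) auto
  then show ?thesis
  proof (rule integrable_eq)
    fix s assume s: "s \<in> {0..T}"
    then have "n s \<le> n T" using n by (auto simp: mono_on_def)
    then show "(\<Sum>i = 1..n T. of_bool (i \<le> n s) *\<^sub>R Y i) = (\<Sum>i = 1..n s. Y i)"
      by (intro sum.mono_neutral_cong_right) auto
  qed
qed

text \<open>As \<open>n\<close> is nondecreasing, the total of the jump norms up to the final time
  \<open>T\<close> bounds the driving term at every earlier time. If this total is infinite the
  claim is trivial, the exponential factor being nonzero.\<close>

lemma trace_dual_step_driven:
  fixes C :: "'h::separable_hilbert_space hs \<Rightarrow>\<^sub>L 'h hs" and D :: "real \<Rightarrow> 'h hs"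
    and n :: "real \<Rightarrow> nat"
  assumes C: "bounded_on_trace_class C" and n: "mono_on {0..} n"
    and D: "\<And>t. t \<ge> 0 \<Longrightarrow> (\<lambda>s. C (D s)) integrable_on {0..t}"
      "\<And>t. t \<ge> 0 \<Longrightarrow> D t = integral {0..t} (\<lambda>s. C (D s)) + (\<Sum>i = 1..n t. Y i)"
    and t: "0 \<le> t" "t \<le> T"
  shows "trace_dual (D t) \<le> ennreal (exp (trace_onorm C * T)) * (\<Sum>i = 1..n T. trace_dual (Y i))"
proof (cases "(\<Sum>i = 1..n T. trace_dual (Y i)) = \<infinity>")
  case True
  then show ?thesis unfolding True by (simp add: ennreal_mult_top)
next
  case False
  then obtain j where j: "(\<Sum>i = 1..n T. trace_dual (Y i)) = ennreal j" "j \<ge> 0"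
    by (cases "\<Sum>i = 1..n T. trace_dual (Y i)") auto
  have "trace_dual (D t) \<le> ennreal (exp (trace_onorm C * t) * j)"
  proof (rule trace_dual_linear_integral_equation[OF C step_function_integrable[OF n, of Y T]])
    fix s assume "s \<in> {0..T}"
    then have "n s \<le> n T" using n by (auto simp: mono_on_def)
    then have "(\<Sum>i = 1..n s. trace_dual (Y i)) \<le> (\<Sum>i = 1..n T. trace_dual (Y i))"
      by (intro sum_mono2) auto
    with j(1) show "trace_dual (\<Sum>i = 1..n s. Y i) \<le> ennreal j"
      using trace_dual_sum[of Y "{1..n s}"] by simp
  qed (use D t j in auto)
  also have "exp (trace_onorm C * t) * j \<le> exp (trace_onorm C * T) * j"
    using t j trace_onorm_nonneg_bound(1)[OF C] by (intro mult_right_mono) (auto intro: mult_left_mono)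
  finally show ?thesis
    using j by (simp add: ennreal_mult ennreal_leI)
qed

section \<open>Compound Poisson sums\<close>

text \<open>Composition with \<open>f\<close> and \<open>g\<close> brings both elements into
  \<open>ennreal\<close>, the common type required by \<open>indep_var\<close>; the sigma-algebras
  generated by the compositions lie inside those of \<open>X\<close> and \<open>Y\<close>.\<close>

lemma indep_elements_nn_integral:
  assumes M: "prob_space M" and ind: "indep_elements M MX X MY Y"
    and f: "f \<in> borel_measurable MX" and g: "g \<in> borel_measurable MY"
  shows "(\<integral>\<^sup>+\<omega>. f (X \<omega>) * g (Y \<omega>) \<partial>M) = (\<integral>\<^sup>+\<omega>. f (X \<omega>) \<partial>M) * (\<integral>\<^sup>+\<omega>. g (Y \<omega>) \<partial>M)"
proof -
  interpret prob_space M by fact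
  have X: "X \<in> measurable M MX" and Y: "Y \<in> measurable M MY"
    and indep: "indep_set (sets (vimage_algebra (space M) X MX)) (sets (vimage_algebra (space M) Y MY))"
    using ind by (auto simp: indep_elements_def)
  have sub: "sigma_sets (space M) {(h \<circ> Z) -` A \<inter> space M | A. A \<in> sets borel}
      \<subseteq> sets (vimage_algebra (space M) Z MZ)"
    if Z: "Z \<in> measurable M MZ" and h: "h \<in> borel_measurable MZ"
    for h :: "'z \<Rightarrow> ennreal" and Z :: "'a \<Rightarrow> 'z" and MZ
  proof -
    let ?V = "vimage_algebra (space M) Z MZ"
    have "Z \<in> measurable ?V MZ"
      using measurable_space[OF Z] by (intro measurable_vimage_algebra1) auto
    then have "h \<circ> Z \<in> borel_measurable ?V"
      by (rule measurable_comp[OF _ h])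
    then have "{(h \<circ> Z) -` A \<inter> space M | A. A \<in> sets borel} \<subseteq> sets ?V"
      using measurable_sets[of "h \<circ> Z" ?V borel] by auto
    from sets.sigma_sets_subset[OF this] show ?thesis by simp
  qed
  have "indep_var borel (f \<circ> X) borel (g \<circ> Y)"
    unfolding indep_var_eq
  proof (intro conjI)
    show "random_variable borel (f \<circ> X)" "random_variable borel (g \<circ> Y)"
      using measurable_comp[OF X f] measurable_comp[OF Y g] .
    show "indep_set (sigma_sets (space M) {(f \<circ> X) -` A \<inter> space M | A. A \<in> sets borel})
        (sigma_sets (space M) {(g \<circ> Y) -` A \<inter> space M | A. A \<in> sets borel})"
    proof (rule indep_setI)
      show "sigma_sets (space M) {(f \<circ> X) -` A \<inter> space M | A. A \<in> sets borel} \<subseteq> events"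
        using sub[OF X f] indep_setD_ev1[OF indep] by blast
      show "sigma_sets (space M) {(g \<circ> Y) -` A \<inter> space M | A. A \<in> sets borel} \<subseteq> events"
        using sub[OF Y g] indep_setD_ev2[OF indep] by blast
    next
      fix a b
      assume "a \<in> sigma_sets (space M) {(f \<circ> X) -` A \<inter> space M | A. A \<in> sets borel}"
        "b \<in> sigma_sets (space M) {(g \<circ> Y) -` A \<inter> space M | A. A \<in> sets borel}"
      then show "prob (a \<inter> b) = prob a * prob b"
        using sub[OF X f] sub[OF Y g] by (intro indep_setD[OF indep]) auto
    qed
  qed
  then have "indep_vars (\<lambda>_. borel) (case_bool (f \<circ> X) (g \<circ> Y)) UNIV"
    unfolding indep_var_def by (simp add: bool.case_eq_if cong: indep_vars_cong)
  from indep_vars_nn_integral[OF _ this] show ?thesis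
    by (simp add: UNIV_bool comp_def mult.commute)
qed

text \<open>The factor n cancels against n!, which leaves r times the exponential series shifted by
  one.\<close>

lemma nn_integral_poisson_pmf:
  assumes "r > 0"
  shows "(\<integral>\<^sup>+n. of_nat n \<partial>measure_pmf (poisson_pmf r)) = ennreal r"
proof -
  let ?f = "\<lambda>n. pmf (poisson_pmf r) n * real n"
  have "(\<lambda>n. r * exp (- r) * (r ^ n /\<^sub>R fact n)) sums (r * exp (- r) * exp r)"
    by (intro sums_mult exp_converges)
  moreover have "?f (Suc n) = r * exp (- r) * (r ^ n /\<^sub>R fact n)" for n
    using assms by (simp add: divide_simps)
  ultimately have "(\<lambda>n. ?f (Suc n)) sums r"
    by (simp add: mult.assoc exp_minus)
  then have "?f sums r"
    by (subst (asm) sums_Suc_iff) simp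
  then have "(\<Sum>n. ennreal (?f n)) = ennreal r"
    by (intro suminf_ennreal_eq) auto
  moreover have "(\<integral>\<^sup>+n. of_nat n \<partial>measure_pmf (poisson_pmf r)) = (\<Sum>n. ennreal (?f n))"
    by (simp add: nn_integral_measure_pmf nn_integral_count_space_nat ennreal_mult
        ennreal_of_nat_eq_real_of_nat)
  ultimately show ?thesis by simp
qed

lemma poisson_process_expectation:
  assumes M: "prob_space M" and N: "poisson_process M r N" and t: "t > 0"
  shows "(\<integral>\<^sup>+\<omega>. of_nat (N t \<omega>) \<partial>M) = ennreal (r * t)"
proof -
  have meas: "N t \<in> measurable M (count_space UNIV)" "N 0 \<in> measurable M (count_space UNIV)" and r: "r > 0"
    and 0: "AE \<omega> in M. N 0 \<omega> = 0"
    and distr: "distr M (count_space UNIV) (\<lambda>\<omega>. N t \<omega> - N 0 \<omega>) = measure_pmf (poisson_pmf (r * t))"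
    using N t unfolding poisson_process_def by auto
  note [measurable] = meas
  \<comment> \<open>\<open>poisson_process\<close> prescribes the law of increments, and
    \<open>N 0\<close> vanishes only almost surely.\<close>
  have "(\<integral>\<^sup>+\<omega>. of_nat (N t \<omega>) \<partial>M) = (\<integral>\<^sup>+\<omega>. of_nat (N t \<omega> - N 0 \<omega>) \<partial>M)"
    by (rule nn_integral_cong_AE) (use 0 in auto)
  also have "\<dots> = (\<integral>\<^sup>+n. of_nat n \<partial>distr M (count_space UNIV) (\<lambda>\<omega>. N t \<omega> - N 0 \<omega>))"
    by (subst nn_integral_distr) auto
  also have "\<dots> = ennreal (r * t)"
    unfolding distr using r t by (intro nn_integral_poisson_pmf) simp
  finally show ?thesis .
qed

text \<open>Trades a random upper limit for indicators in a fixed series, to which measurability and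
  monotone convergence apply. The \<open>Suc\<close> reflects that jumps are numbered from
  1.\<close>

lemma sum_up_to_as_suminf:
  fixes z :: "nat \<Rightarrow> ennreal"
  shows "(\<Sum>i = 1..k. z i) = (\<Sum>i. of_bool (Suc i \<le> k) * z (Suc i))"
proof -
  have "(\<Sum>i. of_bool (Suc i \<le> k) * z (Suc i)) = (\<Sum>i<k. of_bool (Suc i \<le> k) * z (Suc i))"
    by (rule suminf_finite) auto
  also have "\<dots> = (\<Sum>i<k. z (Suc i))" by (intro sum.cong) auto
  also have "\<dots> = (\<Sum>i = 1..k. z i)"
    using sum.atLeast1_atMost_eq[of z k] by simp
  finally show ?thesis ..
qed

text \<open>The i-th term is counted on the event i \<le> K and factorises there; summing the
  probabilities of these events gives the mean of \<open>K\<close>.\<close>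

lemma wald_nn_integral:
  fixes Z :: "nat \<Rightarrow> 'w \<Rightarrow> ennreal" and K :: "'w \<Rightarrow> nat"
  assumes [measurable]: "K \<in> measurable M (count_space UNIV)"
      "\<And>i. i \<ge> 1 \<Longrightarrow> Z i \<in> borel_measurable M"
    and indep: "\<And>i. i \<ge> 1 \<Longrightarrow> (\<integral>\<^sup>+\<omega>. of_bool (i \<le> K \<omega>) * Z i \<omega> \<partial>M)
      = (\<integral>\<^sup>+\<omega>. of_bool (i \<le> K \<omega>) \<partial>M) * (\<integral>\<^sup>+\<omega>. Z i \<omega> \<partial>M)"
    and mean: "\<And>i. i \<ge> 1 \<Longrightarrow> (\<integral>\<^sup>+\<omega>. Z i \<omega> \<partial>M) = m"
  shows "(\<lambda>\<omega>. \<Sum>i = 1..K \<omega>. Z i \<omega>) \<in> borel_measurable M"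
    and "(\<integral>\<^sup>+\<omega>. (\<Sum>i = 1..K \<omega>. Z i \<omega>) \<partial>M) = (\<integral>\<^sup>+\<omega>. of_nat (K \<omega>) \<partial>M) * m"
proof -
  have Z[measurable]: "Z (Suc i) \<in> borel_measurable M" for i by simp
  have b[measurable]: "(\<lambda>\<omega>. of_bool (Suc i \<le> K \<omega>) :: ennreal) \<in> borel_measurable M" for i
    by (rule measurable_compose[OF assms(1)]) simp
  show "(\<lambda>\<omega>. \<Sum>i = 1..K \<omega>. Z i \<omega>) \<in> borel_measurable M"
    unfolding sum_up_to_as_suminf by measurable
  have "(\<integral>\<^sup>+\<omega>. (\<Sum>i = 1..K \<omega>. Z i \<omega>) \<partial>M)
      = (\<Sum>i. \<integral>\<^sup>+\<omega>. of_bool (Suc i \<le> K \<omega>) * Z (Suc i) \<omega> \<partial>M)"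
    unfolding sum_up_to_as_suminf by (rule nn_integral_suminf) measurable
  also have "\<dots> = (\<Sum>i. (\<integral>\<^sup>+\<omega>. of_bool (Suc i \<le> K \<omega>) \<partial>M) * m)"
    by (simp add: indep mean)
  also have "\<dots> = (\<Sum>i. \<integral>\<^sup>+\<omega>. of_bool (Suc i \<le> K \<omega>) \<partial>M) * m"
    by (rule ennreal_suminf_multc)
  also have "(\<Sum>i. \<integral>\<^sup>+\<omega>. of_bool (Suc i \<le> K \<omega>) \<partial>M) = (\<integral>\<^sup>+\<omega>. (\<Sum>i. of_bool (Suc i \<le> K \<omega>)) \<partial>M)"
    by (rule nn_integral_suminf[symmetric]) measurable
  also have "(\<lambda>\<omega>. \<Sum>i. of_bool (Suc i \<le> K \<omega>) :: ennreal) = (\<lambda>\<omega>. of_nat (K \<omega>))"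
    using sum_up_to_as_suminf[of "\<lambda>_. 1"] by auto
  finally show "(\<integral>\<^sup>+\<omega>. (\<Sum>i = 1..K \<omega>. Z i \<omega>) \<partial>M) = (\<integral>\<^sup>+\<omega>. of_nat (K \<omega>) \<partial>M) * m" .
qed

section \<open>Stability of the square root of the variance process\<close>

lemma variance_sqrt_stability:
  fixes C :: "'h::separable_hilbert_space hs \<Rightarrow>\<^sub>L 'h hs"
    and X X' :: "nat \<Rightarrow> 'w \<Rightarrow> 'h hs" and V V' :: "real \<Rightarrow> 'w \<Rightarrow> 'h hs"
  assumes M: "prob_space M" and N: "poisson_process M r N"
    and X: "iid_sequence M X" and X': "iid_sequence M X'"
    and XX': "\<And>i. i \<ge> 1 \<Longrightarrow> distr M (borel \<Otimes>\<^sub>M borel) (\<lambda>\<omega>. (X i \<omega>, X' i \<omega>))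
         = distr M (borel \<Otimes>\<^sub>M borel) (\<lambda>\<omega>. (X 1 \<omega>, X' 1 \<omega>))"
    and indep: "indep_elements M
           (Pi\<^sub>M {1..} (\<lambda>_. borel \<Otimes>\<^sub>M borel)) (\<lambda>\<omega>. \<lambda>i\<in>{1..}. (X i \<omega>, X' i \<omega>))
           (Pi\<^sub>M {0..} (\<lambda>_. count_space UNIV)) (\<lambda>\<omega>. \<lambda>t\<in>{0..}. N t \<omega>)"
    and C: "bounded_on_trace_class C"
    and V: "solves_linear_sde M C V0 (compound_process N X) V"
    and V': "solves_linear_sde M C V0 (compound_process N X') V'"
    and pos: "AE \<omega> in M. \<forall>t\<ge>0. nonneg_definite (op_of_hs (V t \<omega>)) \<and> trace_class (op_of_hs (V t \<omega>))"
    and pos': "AE \<omega> in M. \<forall>t\<ge>0. nonneg_definite (op_of_hs (V' t \<omega>)) \<and> trace_class (op_of_hs (V' t \<omega>))"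
    and i: "i \<ge> 1" and T: "T > 0"
  shows "(\<integral>\<^sup>+\<omega>. (SUP t\<in>{0..T}.
          hs_norm_sq (op_sqrt (op_of_hs (V t \<omega>)) - op_sqrt (op_of_hs (V' t \<omega>)))) \<partial>M)
      \<le> ennreal (exp (trace_onorm C * T) * r * T)
          * (\<integral>\<^sup>+\<omega>. trace_norm (op_of_hs (X i \<omega> - X' i \<omega>)) \<partial>M)"
proof -
  interpret prob_space M by fact
  let ?Y = "\<lambda>i \<omega>. X i \<omega> - X' i \<omega>"
  let ?td = "\<lambda>p :: 'h hs \<times> 'h hs. trace_dual (fst p - snd p)"
  let ?c = "ennreal (exp (trace_onorm C * T))"
  have [measurable]: "X i \<in> borel_measurable M" "X' i \<in> borel_measurable M" if "i \<ge> 1" for i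
    using X X' that by (auto simp: iid_sequence_def indep_vars_def)
  have td [measurable]: "?td \<in> borel_measurable (borel \<Otimes>\<^sub>M borel)" by measurable
  have K: "N T \<in> measurable M (count_space UNIV)" and r: "r > 0"
    and mono: "AE \<omega> in M. mono_on {0..} (\<lambda>t. N t \<omega>)"
    using N T unfolding poisson_process_def by auto
  have Z: "(\<lambda>\<omega>. trace_dual (?Y i \<omega>)) \<in> borel_measurable M" if "i \<ge> 1" for i
    using that by measurable
  \<comment> \<open>The integrand depends on the joint law of the pair, which the laws of the two
    sequences do not determine; \<open>XX'\<close> supplies it.\<close>
  have mean: "(\<integral>\<^sup>+\<omega>. trace_dual (?Y j \<omega>) \<partial>M) = (\<integral>\<^sup>+\<omega>. trace_dual (?Y i \<omega>) \<partial>M)" if "j \<ge> 1" for j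
  proof -
    have *: "(\<integral>\<^sup>+\<omega>. trace_dual (?Y j \<omega>) \<partial>M)
        = (\<integral>\<^sup>+p. ?td p \<partial>distr M (borel \<Otimes>\<^sub>M borel) (\<lambda>\<omega>. (X j \<omega>, X' j \<omega>)))" if "j \<ge> 1" for j
      using that by (subst nn_integral_distr) auto
    show ?thesis unfolding *[OF that] *[OF i] XX'[OF that] XX'[OF i] ..
  qed
  \<comment> \<open>The pair of j-th jumps is a coordinate of the jump family, and the event depends
    on the time-\<open>T\<close> coordinate of \<open>N\<close>; the two families are
    independent.\<close>
  have "(\<integral>\<^sup>+\<omega>. of_bool (j \<le> N T \<omega>) * trace_dual (?Y j \<omega>) \<partial>M)
      = (\<integral>\<^sup>+\<omega>. of_bool (j \<le> N T \<omega>) \<partial>M) * (\<integral>\<^sup>+\<omega>. trace_dual (?Y j \<omega>) \<partial>M)" if j: "j \<ge> 1" for j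
  proof -
    have f: "(\<lambda>p. ?td (p j)) \<in> borel_measurable (Pi\<^sub>M {1..} (\<lambda>_. borel \<Otimes>\<^sub>M borel))"
      by (rule measurable_compose[OF measurable_component_singleton[of j] td]) (use j in simp)
    have g: "(\<lambda>p. of_bool (j \<le> p T) :: ennreal) \<in> borel_measurable (Pi\<^sub>M {0..} (\<lambda>_. count_space UNIV))"
      by (rule measurable_compose[OF measurable_component_singleton[of T]]) (use T in simp_all)
    show ?thesis
      using indep_elements_nn_integral[OF M indep f g] j T by (simp add: mult.commute)
  qed
  note wald = wald_nn_integral[OF K Z this mean]

  have "AE \<omega> in M. (SUP t\<in>{0..T}.
        hs_norm_sq (op_sqrt (op_of_hs (V t \<omega>)) - op_sqrt (op_of_hs (V' t \<omega>))))
      \<le> ?c * (\<Sum>j = 1..N T \<omega>. trace_dual (?Y j \<omega>))"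
    using mono pos pos' V[unfolded solves_linear_sde_def, THEN conjunct2]
      V'[unfolded solves_linear_sde_def, THEN conjunct2]
  proof eventually_elim
    case (elim \<omega>)
    define D where "D t = V t \<omega> - V' t \<omega>" for t
    have CD: "(\<lambda>s. C (D s)) = (\<lambda>s. C (V s \<omega>) - C (V' s \<omega>))"
      by (simp add: D_def blinfun.diff_right)
    have int: "(\<lambda>s. C (D s)) integrable_on {0..t}" if "t \<ge> 0" for t
      unfolding CD using elim(4,5) that by (intro integrable_diff) auto
    \<comment> \<open>The common initial value cancels, so \<open>D\<close> is driven by the jump
      differences alone.\<close>
    have eq: "D t = integral {0..t} (\<lambda>s. C (D s)) + (\<Sum>j = 1..N t \<omega>. ?Y j \<omega>)" if "t \<ge> 0" for t
    proof -
      have iV: "(\<lambda>s. C (V s \<omega>)) integrable_on {0..t}" "(\<lambda>s. C (V' s \<omega>)) integrable_on {0..t}"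
        and eV: "V t \<omega> = V0 \<omega> + integral {0..t} (\<lambda>s. C (V s \<omega>)) + compound_process N X t \<omega>"
          "V' t \<omega> = V0 \<omega> + integral {0..t} (\<lambda>s. C (V' s \<omega>)) + compound_process N X' t \<omega>"
        using elim(4,5) that by blast+
      have "V t \<omega> - V' t \<omega>
          = (integral {0..t} (\<lambda>s. C (V s \<omega>)) - integral {0..t} (\<lambda>s. C (V' s \<omega>)))
            + (compound_process N X t \<omega> - compound_process N X' t \<omega>)"
        unfolding eV by (rule add_diff_add[THEN trans]) simp
      then show ?thesis
        unfolding CD integral_diff[OF iV] by (simp add: D_def compound_process_def sum_subtractf)
    qed
    show ?case
    proof (rule SUP_least)
      fix t assume "t \<in> {0..T}"
      then have t: "0 \<le> t" "t \<le> T" by auto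
      have "hs_norm_sq (op_sqrt (op_of_hs (V t \<omega>)) - op_sqrt (op_of_hs (V' t \<omega>))) \<le> trace_dual (D t)"
        unfolding D_def using elim(2,3) t by (intro powers_stormer) auto
      also have "\<dots> \<le> ?c * (\<Sum>j = 1..N T \<omega>. trace_dual (?Y j \<omega>))"
        by (rule trace_dual_step_driven[OF C elim(1) int eq t])
      finally show "hs_norm_sq (op_sqrt (op_of_hs (V t \<omega>)) - op_sqrt (op_of_hs (V' t \<omega>)))
          \<le> ?c * (\<Sum>j = 1..N T \<omega>. trace_dual (?Y j \<omega>))" .
    qed
  qed
  then have "(\<integral>\<^sup>+\<omega>. (SUP t\<in>{0..T}.
          hs_norm_sq (op_sqrt (op_of_hs (V t \<omega>)) - op_sqrt (op_of_hs (V' t \<omega>)))) \<partial>M)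
      \<le> (\<integral>\<^sup>+\<omega>. ?c * (\<Sum>j = 1..N T \<omega>. trace_dual (?Y j \<omega>)) \<partial>M)"
    by (rule nn_integral_mono_AE)
  also have "\<dots> = ?c * (\<integral>\<^sup>+\<omega>. (\<Sum>j = 1..N T \<omega>. trace_dual (?Y j \<omega>)) \<partial>M)"
    by (rule nn_integral_cmult[OF wald(1)])
  also have "\<dots> = ?c * (ennreal (r * T) * (\<integral>\<^sup>+\<omega>. trace_dual (?Y i \<omega>) \<partial>M))"
    by (simp only: wald(2) poisson_process_expectation[OF M N T])
  also have "\<dots> = ennreal (exp (trace_onorm C * T) * r * T) * (\<integral>\<^sup>+\<omega>. trace_dual (?Y i \<omega>) \<partial>M)"
    using r T by (simp add: ennreal_mult mult.assoc)
  finally show ?thesis by (simp add: trace_norm_eq_trace_dual)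
qed

theorem corollary5:
  fixes M :: "'w measure" and N :: "real \<Rightarrow> 'w \<Rightarrow> nat" and lam :: real
    and C :: "'h::separable_hilbert_space hs \<Rightarrow>\<^sub>L 'h hs"
    and Cn :: "nat \<Rightarrow> 'h hs \<Rightarrow>\<^sub>L 'h hs"
    and V0 :: "'w \<Rightarrow> 'h hs" and V0n :: "nat \<Rightarrow> 'w \<Rightarrow> 'h hs"
    and X :: "nat \<Rightarrow> 'w \<Rightarrow> 'h hs" and Xn :: "nat \<Rightarrow> nat \<Rightarrow> 'w \<Rightarrow> 'h hs"
    and V :: "real \<Rightarrow> 'w \<Rightarrow> 'h hs" and Vn :: "nat \<Rightarrow> real \<Rightarrow> 'w \<Rightarrow> 'h hs"
  assumes "prob_space M"
    and "poisson_process M lam N"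
    and "iid_sequence M X"
    and "\<And>n. n \<ge> 1 \<Longrightarrow> iid_sequence M (Xn n)"
    and "\<And>n i. n \<ge> 1 \<Longrightarrow> i \<ge> 1 \<Longrightarrow>
           distr M (borel \<Otimes>\<^sub>M borel) (\<lambda>\<omega>. (X i \<omega>, Xn n i \<omega>))
         = distr M (borel \<Otimes>\<^sub>M borel) (\<lambda>\<omega>. (X 1 \<omega>, Xn n 1 \<omega>))"
    and "\<And>n. n \<ge> 1 \<Longrightarrow> indep_elements M
           (Pi\<^sub>M {1..} (\<lambda>_. borel \<Otimes>\<^sub>M borel)) (\<lambda>\<omega>. \<lambda>i\<in>{1..}. (X i \<omega>, Xn n i \<omega>))
           (Pi\<^sub>M {0..} (\<lambda>_. count_space UNIV)) (\<lambda>\<omega>. \<lambda>t\<in>{0..}. N t \<omega>)"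
    and "bounded_on_trace_class C"
    and "V0 \<in> borel_measurable M"
    and "\<And>n. n \<ge> 1 \<Longrightarrow> V0n n = V0"
    and "\<And>n. n \<ge> 1 \<Longrightarrow> Cn n = C"
    and "solves_linear_sde M C V0 (compound_process N X) V"
    and "\<And>n. n \<ge> 1 \<Longrightarrow> solves_linear_sde M (Cn n) (V0n n) (compound_process N (Xn n)) (Vn n)"
    and "AE \<omega> in M. \<forall>t\<ge>0. nonneg_definite (op_of_hs (V t \<omega>)) \<and> trace_class (op_of_hs (V t \<omega>))"
    and "\<And>n. n \<ge> 1 \<Longrightarrow>
           AE \<omega> in M. \<forall>t\<ge>0. nonneg_definite (op_of_hs (Vn n t \<omega>)) \<and> trace_class (op_of_hs (Vn n t \<omega>))"
  shows "\<exists>k>0. \<forall>n\<ge>1. \<forall>i\<ge>1. \<forall>T>0.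
      (\<integral>\<^sup>+\<omega>. (SUP t\<in>{0..T}.
          hs_norm_sq (op_sqrt (op_of_hs (V t \<omega>)) - op_sqrt (op_of_hs (Vn n t \<omega>)))) \<partial>M)
      \<le> ennreal (k * exp (trace_onorm C * T) * lam * T)
          * (\<integral>\<^sup>+\<omega>. trace_norm (op_of_hs (X i \<omega> - Xn n i \<omega>)) \<partial>M)"
proof (intro exI[of _ 1] conjI allI impI)
  fix n i :: nat and T :: real assume n: "1 \<le> n" and i: "1 \<le> i" and T: "0 < T"
  have "solves_linear_sde M C V0 (compound_process N (Xn n)) (Vn n)"
    using assms(12)[OF n] assms(9)[OF n] assms(10)[OF n] by simp
  from variance_sqrt_stability[OF assms(1,2,3) assms(4)[OF n] assms(5)[OF n] assms(6)[OF n]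
      assms(7) assms(11) this assms(13) assms(14)[OF n] i T]
  show "(\<integral>\<^sup>+\<omega>. (SUP t\<in>{0..T}.
          hs_norm_sq (op_sqrt (op_of_hs (V t \<omega>)) - op_sqrt (op_of_hs (Vn n t \<omega>)))) \<partial>M)
      \<le> ennreal (1 * exp (trace_onorm C * T) * lam * T)
          * (\<integral>\<^sup>+\<omega>. trace_norm (op_of_hs (X i \<omega> - Xn n i \<omega>)) \<partial>M)"
    by simp
qed simp

end
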